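(* Consider the sparse sequence model with independent $X_i\sim f_{\theta_i}$, $1\le i\le n$, in the asymptotics $n\to\infty$, $s_n\to\infty$, $n/s_n\to\infty$, and suppose Assumption 1 (stated in the context) holds, with sequences $a_n^*,\delta_n$. Let $\boldsymbol a=(a_1,\dots,a_{s_n})$ (implicitly indexed by $n$) with $a_j>0$, let $$\Theta(\boldsymbol a,s_n)=\{\theta\in\ell_0[s_n]:\ \exists\, i_1,\dots,i_{s_n}\ \text{all distinct},\ |\theta_{i_j}|\ge a_j,\ 1\le j\le s_n\},$$ and $\Lambda_n(\boldsymbol a)=s_n^{-1}\sum_{j=1}^{s_n}F_{a_j}(a_n^* )$. For any sequence $B=(B_n)_n$ with $B_n^2\le\tfrac13(n/s_n)\overline F_0(a_n^*-\delta_n)$ and $\varliminf_nB_n>1$, let $\mathcal S_B$ denote the set of procedures that are sparsity-preserving over $\Theta(\boldsymbol a,s_n)$ up to the multiplicative factor $B$. Then: - under Assumption 1.A, $\displaystyle\inf_{\varphi\in\mathcal S_B}\sup_{\theta\in\Theta(\boldsymbol a,s_n)}\mathrm{FNR}(\theta,\varphi)=\Lambda_n(\boldsymbol a)+o(1)$; - under Assumption 1.B, $\displaystyle\inf_{\varphi\in\mathcal S_B}\sup_{\theta\in\Theta(\boldsymbol a,s_n)}\mathrm{FNR}(\theta,\varphi)=2\Lambda_n(\boldsymbol a)-1+o(1)$. In each case the bound is achieved by the thresholding procedure $\varphi_i(X)=\mathbf 1\{|X_i|>a_n^*\}$.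
   Context: Model: $(f_a:a\in\mathbb R)$ is a family of probability densities on $\mathbb R$, $F_a(x)=\int_{-\infty}^xf_a(t)\,dt$, $\overline F_a=1-F_a$. For $\theta\in\mathbb R^n$ deterministic, $X_1,\dots,X_n$ are independent with $X_i\sim f_{\theta_i}$; $P_\theta,E_\theta$ denote the law and expectation. $(s_n)$ is a sequence of integers. $\ell_0[s]=\{\theta\in\mathbb R^n:\#\{i:\theta_i\ne0\}\le s\}$. Assumption 1. There is a constant $L$ such that each $F_a$ is $L$-Lipschitz. There exist sequences of positive numbers $a_n^*\to\infty$, $\delta_n\to0$ such that $(n/s_n)\overline F_0(a_n^*-\delta_n)\to\infty$ and $(n/s_n)\overline F_0(a_n^* )\to0$. The density $f_0$ is continuous and positive on $\mathbb R$. Further, one of the following holds: (A) $f_{-a}(-x)=f_a(x)$ for all $a,x\in\mathbb R$; $\overline F_a(x)$ is increasing in $a\in\mathbb R$; and for $a>0$, $f_a(x)/f_0(x)$ is increasing in $x\in\mathbb R$. (B) $f_a(-x)=f_a(x)$ for all $a,x\in\mathbb R$; $\overline F_a(x)$ is increasing in $a>0$ for $x>0$; and for $a\ne0$, $f_a(x)/f_0(x)$ is increasing in $x>0$. "Assumption 1.A" (resp. "1.B") means Assumption 1 with (A) (resp. (B)). A multiple testing procedure is (a sequence in $n$ of) measurable maps $\varphi:\mathbb R^n\to\{0,1\}^n$. $\mathrm{FNR}(\theta,\varphi)=E_\theta\left[\frac{\sum_i\mathbf 1\{\theta_i\ne0\}(1-\varphi_i(X))}{1\vee\sum_i\mathbf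 1\{\theta_i\ne0\}}\right]$. A sequence of procedures $\varphi$ is sparsity-preserving over $\Theta=(\Theta_n)_n$ up to a multiplicative factor $A=(A_n)_n$ if, as $n\to\infty$, $\sup_{\theta\in\Theta_n}P_\theta\left[\sum_{i=1}^n\varphi_i(X)>A_ns_n\right]=o(1)$. Convention: since $\mathcal S_B$ is a class of sequences of procedures, "$\inf_{\varphi\in\mathcal S_B}\sup_\theta \mathrm{FNR}(\theta,\varphi)=L_n+o(1)$" means: every sequence $\varphi\in\mathcal S_B$ satisfies $\sup_\theta\mathrm{FNR}(\theta,\varphi)\ge L_n-o(1)$, and some sequence in $\mathcal S_B$ satisfies $\sup_\theta\mathrm{FNR}(\theta,\varphi)\le L_n+o(1)$.
   Formalization: Under Assumption 1.B, the upper bound (achievability, hence equality) is proved only if also F̄_a(x) ≤ F̄_{-a}(x) for all a,x>0 (true when f_{-a}=f_a); without a link between f_a and f_{-a} it is false. The lower bound and thresholding being in S_B need no such condition. *)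

theory Defs
  imports "HOL-Probability.Probability"
begin

definition density_family :: "(real \<Rightarrow> real \<Rightarrow> real) \<Rightarrow> bool" where
  "density_family f \<longleftrightarrow>
     (\<forall>a. f a \<in> borel_measurable borel \<and> (\<forall>x. 0 \<le> f a x) \<and>
          (\<integral>\<^sup>+ x. ennreal (f a x) \<partial>lborel) = 1)"

definition Fcdf :: "(real \<Rightarrow> real \<Rightarrow> real) \<Rightarrow> real \<Rightarrow> real \<Rightarrow> real" where
  "Fcdf f a x = (LINT t:{..x}|lborel. f a t)"

definition Fbar :: "(real \<Rightarrow> real \<Rightarrow> real) \<Rightarrow> real \<Rightarrow> real \<Rightarrow> real" where
  "Fbar f a x = 1 - Fcdf f a x"

text \<open>
  A point of \<open>n\<close>-dimensional space is a function on \<open>nat\<close> in the extensional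
  function space over \<open>{1..n}\<close>, so that \<open>n\<close> can vary inside a statement.
\<close>

definition obs_law ::
  "(real \<Rightarrow> real \<Rightarrow> real) \<Rightarrow> nat \<Rightarrow> (nat \<Rightarrow> real) \<Rightarrow> (nat \<Rightarrow> real) measure" where
  "obs_law f n \<theta> = (\<Pi>\<^sub>M i\<in>{1..n}. density lborel (\<lambda>x. ennreal (f (\<theta> i) x)))"

definition assumption_1_common ::
  "(real \<Rightarrow> real \<Rightarrow> real) \<Rightarrow> (nat \<Rightarrow> nat) \<Rightarrow> (nat \<Rightarrow> real) \<Rightarrow> (nat \<Rightarrow> real) \<Rightarrow> bool" where
  "assumption_1_common f s astar \<delta> \<longleftrightarrow>
     (\<exists>L. \<forall>a. L-lipschitz_on UNIV (Fcdf f a)) \<and>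
     (\<forall>n. 0 < astar n) \<and> filterlim astar at_top sequentially \<and>
     (\<forall>n. 0 < \<delta> n) \<and> \<delta> \<longlonglongrightarrow> 0 \<and>
     filterlim (\<lambda>n. real n / real (s n) * Fbar f 0 (astar n - \<delta> n)) at_top sequentially \<and>
     (\<lambda>n. real n / real (s n) * Fbar f 0 (astar n)) \<longlonglongrightarrow> 0 \<and>
     continuous_on UNIV (f 0) \<and> (\<forall>x. 0 < f 0 x)"

text \<open>``Increasing'' is understood in the weak sense (nondecreasing) throughout.\<close>

definition assumption_1A ::
  "(real \<Rightarrow> real \<Rightarrow> real) \<Rightarrow> (nat \<Rightarrow> nat) \<Rightarrow> (nat \<Rightarrow> real) \<Rightarrow> (nat \<Rightarrow> real) \<Rightarrow> bool" where
  "assumption_1A f s astar \<delta> \<longleftrightarrow>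
     assumption_1_common f s astar \<delta> \<and>
     (\<forall>a x. f (- a) (- x) = f a x) \<and>
     (\<forall>x. mono (\<lambda>a. Fbar f a x)) \<and>
     (\<forall>a>0. mono (\<lambda>x. f a x / f 0 x))"

definition assumption_1B ::
  "(real \<Rightarrow> real \<Rightarrow> real) \<Rightarrow> (nat \<Rightarrow> nat) \<Rightarrow> (nat \<Rightarrow> real) \<Rightarrow> (nat \<Rightarrow> real) \<Rightarrow> bool" where
  "assumption_1B f s astar \<delta> \<longleftrightarrow>
     assumption_1_common f s astar \<delta> \<and>
     (\<forall>a x. f a (- x) = f a x) \<and>
     (\<forall>x>0. mono_on {0<..} (\<lambda>a. Fbar f a x)) \<and>
     (\<forall>a. a \<noteq> 0 \<longrightarrow> mono_on {0<..} (\<lambda>x. f a x / f 0 x))"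

text \<open>
  \<^const>\<open>assumption_1B\<close> does not relate a negative parameter to the corresponding positive
  one, whereas the parameter sets below constrain only absolute values. The following
  condition supplies the missing link; it holds with equality if \<open>f (- a) = f a\<close>.
\<close>

definition negative_tails_dominate :: "(real \<Rightarrow> real \<Rightarrow> real) \<Rightarrow> bool" where
  "negative_tails_dominate f \<longleftrightarrow> (\<forall>a>0. \<forall>x>0. Fbar f a x \<le> Fbar f (- a) x)"

definition l0_ball :: "nat \<Rightarrow> nat \<Rightarrow> (nat \<Rightarrow> real) set" where
  "l0_ball n s = {\<theta> \<in> {1..n} \<rightarrow>\<^sub>E UNIV. card {i \<in> {1..n}. \<theta> i \<noteq> 0} \<le> s}"

definition Theta :: "(nat \<Rightarrow> nat \<Rightarrow> real) \<Rightarrow> (nat \<Rightarrow> nat) \<Rightarrow> nat \<Rightarrow> (nat \<Rightarrow> real) set" where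
  "Theta a s n =
     {\<theta> \<in> l0_ball n (s n). \<exists>\<iota>. inj_on \<iota> {1..s n} \<and> \<iota> ` {1..s n} \<subseteq> {1..n} \<and>
        (\<forall>j\<in>{1..s n}. \<bar>\<theta> (\<iota> j)\<bar> \<ge> a n j)}"

definition Lambda ::
  "(real \<Rightarrow> real \<Rightarrow> real) \<Rightarrow> (nat \<Rightarrow> nat) \<Rightarrow> (nat \<Rightarrow> real) \<Rightarrow> (nat \<Rightarrow> nat \<Rightarrow> real) \<Rightarrow> nat \<Rightarrow> real" where
  "Lambda f s astar a n = (\<Sum>j=1..s n. Fcdf f (a n j) (astar n)) / real (s n)"

text \<open>\<open>\<phi> n x i\<close> means that the \<open>i\<close>-th null hypothesis is rejected on observing \<open>x\<close>.\<close>

type_synonym procedures = "nat \<Rightarrow> (nat \<Rightarrow> real) \<Rightarrow> nat \<Rightarrow> bool"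

definition testing_procedure :: "procedures \<Rightarrow> bool" where
  "testing_procedure \<phi> \<longleftrightarrow>
     (\<forall>n. \<forall>i\<in>{1..n}. (\<lambda>x. \<phi> n x i) \<in> measurable (\<Pi>\<^sub>M i\<in>{1..n}. borel) (count_space UNIV))"

definition FNR ::
  "(real \<Rightarrow> real \<Rightarrow> real) \<Rightarrow> procedures \<Rightarrow> nat \<Rightarrow> (nat \<Rightarrow> real) \<Rightarrow> real" where
  "FNR f \<phi> n \<theta> =
     (\<integral>x. (\<Sum>i=1..n. of_bool (\<theta> i \<noteq> 0) * (1 - of_bool (\<phi> n x i))) /
          max 1 (\<Sum>i=1..n. of_bool (\<theta> i \<noteq> 0)) \<partial>obs_law f n \<theta>)"

text \<open>
  The suprema below are taken over sets of reals contained in \<open>{0..1}\<close>; they are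
  meaningful as soon as \<open>\<Theta> n\<close> is nonempty, and only their behaviour for large \<open>n\<close> matters.
\<close>

definition sup_FNR ::
  "(real \<Rightarrow> real \<Rightarrow> real) \<Rightarrow> (nat \<Rightarrow> (nat \<Rightarrow> real) set) \<Rightarrow> procedures \<Rightarrow> nat \<Rightarrow> real" where
  "sup_FNR f \<Theta> \<phi> n = (SUP \<theta>\<in>\<Theta> n. FNR f \<phi> n \<theta>)"

definition sparsity_preserving ::
  "(real \<Rightarrow> real \<Rightarrow> real) \<Rightarrow> (nat \<Rightarrow> nat) \<Rightarrow> (nat \<Rightarrow> (nat \<Rightarrow> real) set) \<Rightarrow> (nat \<Rightarrow> real) \<Rightarrow>
     procedures \<Rightarrow> bool" where
  "sparsity_preserving f s \<Theta> A \<phi> \<longleftrightarrow>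
     (\<lambda>n. SUP \<theta>\<in>\<Theta> n. measure (obs_law f n \<theta>)
        {x \<in> space (obs_law f n \<theta>). (\<Sum>i=1..n. of_bool (\<phi> n x i)) > A n * real (s n)})
     \<longlonglongrightarrow> 0"

definition sparsity_preserving_class ::
  "(real \<Rightarrow> real \<Rightarrow> real) \<Rightarrow> (nat \<Rightarrow> nat) \<Rightarrow> (nat \<Rightarrow> (nat \<Rightarrow> real) set) \<Rightarrow> (nat \<Rightarrow> real) \<Rightarrow>
     procedures set" where
  "sparsity_preserving_class f s \<Theta> A =
     {\<phi>. testing_procedure \<phi> \<and> sparsity_preserving f s \<Theta> A \<phi>}"

definition le_up_to_o1 :: "(nat \<Rightarrow> real) \<Rightarrow> (nat \<Rightarrow> real) \<Rightarrow> bool" where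
  "le_up_to_o1 u v \<longleftrightarrow> (\<exists>e. e \<longlonglongrightarrow> 0 \<and> (\<forall>n. u n \<le> v n + e n))"

text \<open>
  The meaning given to \<open>inf\<^bsub>\<phi>\<in>S\<^esub> R \<phi> n = l n + o(1)\<close> when \<open>S\<close> is a class of sequences
  of procedures; the remainder may depend on the sequence.
\<close>

definition inf_eq_up_to_o1 ::
  "procedures set \<Rightarrow> (procedures \<Rightarrow> nat \<Rightarrow> real) \<Rightarrow> (nat \<Rightarrow> real) \<Rightarrow> bool" where
  "inf_eq_up_to_o1 S R l \<longleftrightarrow>
     (\<forall>\<phi>\<in>S. le_up_to_o1 l (R \<phi>)) \<and> (\<exists>\<phi>\<in>S. le_up_to_o1 (R \<phi>) l)"

definition threshold_procedure :: "(nat \<Rightarrow> real) \<Rightarrow> procedures" where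
  "threshold_procedure t n x i \<longleftrightarrow> \<bar>x i\<bar> > t n"

end

theory Submission
  imports Defs "HOL-Real_Asymp.Real_Asymp"
begin

text \<open>
  For the lower bound, cut \<open>{1..n}\<close> into \<open>s\<close> blocks of size \<open>m = n div s\<close> and put the signal
  \<open>a\<^sub>j\<close> at a uniformly random position of block \<open>j\<close>. Let \<open>t = astar - \<delta>\<close> and let \<open>K\<^sub>j\<close> be the number
  of rejections in block \<open>j\<close>. Rejections in a block with \<open>K\<^sub>j \<le> k\<close>, where \<open>k = m * Fbar f 0 t\<close>,
  number at most as many as thresholding at \<open>t\<close> rejects on average under the null hypothesis, so by
  the Neyman--Pearson argument they hit the signal with probability at most that of thresholding.
  Blocks with \<open>K\<^sub>j > k\<close> are rare: a sparsity-preserving procedure has at most \<open>B s / k\<close> of them with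
  high probability, and \<open>B / k \<longlonglongrightarrow> 0\<close> because \<open>B\<^sup>2\<close> is at most of the order of \<open>k\<close>, which diverges.
  Finally \<open>t\<close> is replaced by \<open>astar\<close> using the Lipschitz condition.

  Thresholding at \<open>astar\<close> attains the bound by monotonicity of the tails, and preserves sparsity by
  Markov's inequality for the number of false discoveries.
\<close>

section \<open>The observation law as a product measure, and change of measure in one
  coordinate\<close>

definition signal_law :: "(real \<Rightarrow> real \<Rightarrow> real) \<Rightarrow> real \<Rightarrow> real measure" where
  "signal_law f a = density lborel (\<lambda>x. ennreal (f a x))"

lemma space_signal_law [simp]: "space (signal_law f a) = UNIV"
  by (simp add: signal_law_def)

lemma sets_signal_law [simp, measurable_cong]: "sets (signal_law f a) = sets borel"
  by (simp add: signal_law_def)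

lemma obs_law_eq: "obs_law f n \<theta> = (\<Pi>\<^sub>M i\<in>{1..n}. signal_law f (\<theta> i))"
  by (simp add: obs_law_def signal_law_def)

lemma space_obs_law: "space (obs_law f n \<theta>) = {1..n} \<rightarrow>\<^sub>E UNIV"
  by (simp add: obs_law_eq space_PiM)

lemma sets_obs_law: "sets (obs_law f n \<theta>) = sets (\<Pi>\<^sub>M i\<in>{1..n}. borel)"
  unfolding obs_law_eq by (rule sets_PiM_cong) auto

lemma obs_law_cong:
  "(\<And>i. i \<in> {1..n} \<Longrightarrow> \<theta> i = \<theta>' i) \<Longrightarrow> obs_law f n \<theta> = obs_law f n \<theta>'"
  unfolding obs_law_eq by (rule PiM_cong) auto

lemma measurable_obs_law:
  "measurable (obs_law f n \<theta>) N = measurable (\<Pi>\<^sub>M i\<in>{1..n}. borel) N"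
  by (rule measurable_cong_sets) (auto simp: sets_obs_law)

lemma prob_space_signal_law:
  assumes "density_family f"
  shows "prob_space (signal_law f a)"
proof
  have "f a \<in> borel_measurable borel" using assms by (simp add: density_family_def)
  then show "emeasure (signal_law f a) (space (signal_law f a)) = 1"
    using assms by (simp add: signal_law_def emeasure_density density_family_def)
qed

lemma product_prob_space_signal_law:
  assumes "density_family f"
  shows "product_prob_space (\<lambda>i. signal_law f (\<theta> i))"
proof -
  interpret prob_space "signal_law f (\<theta> i)" for i
    using assms by (rule prob_space_signal_law)
  show ?thesis by unfold_locales
qed

lemma prob_space_obs_law:
  assumes "density_family f"
  shows "prob_space (obs_law f n \<theta>)"
  unfolding obs_law_eq using assms by (intro prob_space_PiM prob_space_signal_law)

lemma emeasure_obs_law_component: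
  assumes "density_family f" "i \<in> {1..n}" "A \<in> sets borel"
  shows "emeasure (obs_law f n \<theta>) {x \<in> space (obs_law f n \<theta>). x i \<in> A} = emeasure (signal_law f (\<theta> i)) A"
proof -
  interpret product_prob_space "\<lambda>i. signal_law f (\<theta> i)" "{1..n}"
    using assms(1) by (rule product_prob_space_signal_law)
  have "emeasure (signal_law f (\<theta> i)) A
      = emeasure (distr (obs_law f n \<theta>) (signal_law f (\<theta> i)) (\<lambda>\<omega>. \<omega> i)) A"
    using PiM_component[OF assms(2)] by (simp add: obs_law_eq)
  also have "\<dots> = emeasure (obs_law f n \<theta>) ((\<lambda>\<omega>. \<omega> i) -` A \<inter> space (obs_law f n \<theta>))"
    using assms by (intro emeasure_distr) (auto simp: obs_law_eq)
  also have "(\<lambda>\<omega>. \<omega> i) -` A \<inter> space (obs_law f n \<theta>) = {x \<in> space (obs_law f n \<theta>). x i \<in> A}"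
    by auto
  finally show ?thesis by simp
qed

lemma measure_obs_law_component:
  assumes "density_family f" "i \<in> {1..n}" "A \<in> sets borel"
  shows "measure (obs_law f n \<theta>) {x \<in> space (obs_law f n \<theta>). x i \<in> A} = measure (signal_law f (\<theta> i)) A"
  using emeasure_obs_law_component[OF assms] by (simp add: measure_def)

text \<open>By Tonelli, coordinate \<open>i\<close> is integrated first, where the density
  \<open>r\<close> turns the law of \<open>a\<close> into that of \<open>b\<close>; the other
  coordinates have the same law on both sides. This compares a signal at \<open>i\<close> with the
  configuration lacking it.\<close>

lemma nn_integral_obs_law_upd:
  assumes f: "density_family f" and i: "i \<in> {1..n}"
    and r: "signal_law f a = density (signal_law f b) r" "r \<in> borel_measurable borel"
    and g: "g \<in> borel_measurable (\<Pi>\<^sub>M i\<in>{1..n}. borel)"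
  shows "(\<integral>\<^sup>+x. g x \<partial>obs_law f n (\<theta>(i := a))) = (\<integral>\<^sup>+x. r (x i) * g x \<partial>obs_law f n (\<theta>(i := b)))"
proof -
  define I where "I = {1..n} - {i}"
  have I: "{1..n} = insert i I" "finite I" "i \<notin> I" using i by (auto simp: I_def)
  \<comment> \<open>With coordinate \<open>i\<close> innermost, the outer product does not involve
    \<open>c\<close>, so one formula serves both \<open>a\<close> and \<open>b\<close>.\<close>
  have fold: "(\<integral>\<^sup>+x. h x \<partial>obs_law f n (\<theta>(i := c)))
      = (\<integral>\<^sup>+x. \<integral>\<^sup>+y. h (x(i := y)) \<partial>signal_law f c \<partial>(\<Pi>\<^sub>M k\<in>I. signal_law f (\<theta> k)))"
    if h: "h \<in> borel_measurable (\<Pi>\<^sub>M i\<in>{1..n}. borel)" for h c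
  proof -
    interpret product_prob_space "\<lambda>k. signal_law f ((\<theta>(i := c)) k)"
      using f by (rule product_prob_space_signal_law)
    have "h \<in> borel_measurable (obs_law f n (\<theta>(i := c)))"
      using h by (simp add: measurable_obs_law)
    then have "(\<integral>\<^sup>+x. h x \<partial>obs_law f n (\<theta>(i := c)))
      = (\<integral>\<^sup>+x. \<integral>\<^sup>+y. h (x(i := y)) \<partial>signal_law f ((\<theta>(i := c)) i)
           \<partial>(\<Pi>\<^sub>M k\<in>I. signal_law f ((\<theta>(i := c)) k)))"
      unfolding obs_law_eq I(1) by (rule product_nn_integral_insert[OF I(2,3)])
    also have "(\<Pi>\<^sub>M k\<in>I. signal_law f ((\<theta>(i := c)) k)) = (\<Pi>\<^sub>M k\<in>I. signal_law f (\<theta> k))"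
      by (rule PiM_cong) (use I in auto)
    finally show ?thesis by (simp only: fun_upd_same)
  qed
  note [measurable] = r(2) g
  have rg: "(\<lambda>x. r (x i) * g x) \<in> borel_measurable (\<Pi>\<^sub>M i\<in>{1..n}. borel)"
    using i by measurable
  have "(\<integral>\<^sup>+x. g x \<partial>obs_law f n (\<theta>(i := a)))
      = (\<integral>\<^sup>+x. \<integral>\<^sup>+y. g (x(i := y)) \<partial>signal_law f a \<partial>(\<Pi>\<^sub>M k\<in>I. signal_law f (\<theta> k)))"
    by (rule fold[OF g])
  also have "\<dots> = (\<integral>\<^sup>+x. \<integral>\<^sup>+y. r y * g (x(i := y)) \<partial>signal_law f b \<partial>(\<Pi>\<^sub>M k\<in>I. signal_law f (\<theta> k)))"
  proof (rule nn_integral_cong)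
    fix x assume "x \<in> space (\<Pi>\<^sub>M k\<in>I. signal_law f (\<theta> k))"
    then have x: "x \<in> space (\<Pi>\<^sub>M k\<in>I. borel)" by (simp add: space_PiM)
    have "(\<lambda>y. x(i := y)) \<in> measurable borel (\<Pi>\<^sub>M k\<in>{1..n}. borel)"
      unfolding I(1) using x I by (intro measurable_fun_upd[where J=I]) auto
    then have "(\<lambda>y. g (x(i := y))) \<in> borel_measurable borel"
      using g by (rule measurable_compose)
    then show "(\<integral>\<^sup>+y. g (x(i := y)) \<partial>signal_law f a) = (\<integral>\<^sup>+y. r y * g (x(i := y)) \<partial>signal_law f b)"
      unfolding r(1) using r(2) by (intro nn_integral_density) auto
  qed
  also have "\<dots> = (\<integral>\<^sup>+x. r (x i) * g x \<partial>obs_law f n (\<theta>(i := b)))"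
    using fold[OF rg] by simp
  finally show ?thesis .
qed

section \<open>Likelihood ratio tests and a Neyman-Pearson bound over a block\<close>

text \<open>Rejection regions of Neyman-Pearson tests of \<open>b\<close> against \<open>a\<close>,
  with cutoff \<open>c\<close>. Only some version \<open>r\<close> of the likelihood ratio has to
  obey the cutoff, so its values on a null set are free; points with \<open>r x = c\<close> may lie
  on either side.\<close>

definition likelihood_ratio_test :: "(real \<Rightarrow> real \<Rightarrow> real) \<Rightarrow> real \<Rightarrow> real \<Rightarrow> real set \<Rightarrow> bool" where
  "likelihood_ratio_test f b a T \<longleftrightarrow> T \<in> sets borel \<and>
     (\<exists>r c. r \<in> borel_measurable borel \<and> signal_law f a = density (signal_law f b) (\<lambda>x. ennreal (r x)) \<and>
        0 \<le> c \<and> (\<forall>x\<in>T. c \<le> r x) \<and> (\<forall>x. x \<notin> T \<longrightarrow> r x \<le> c))"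

text \<open>The pointwise Neyman-Pearson inequality is integrated under \<open>\<theta>\<close>,
  which equals \<open>b\<close> on the whole block, and summed over the positions in the block. The
  cap \<open>k\<close> makes the total probability of the \<open>A i\<close> under
  \<open>\<theta>\<close> at most that of the tests \<open>T\<close>, so the terms with factor
  \<open>c\<close> drop out in the right direction.\<close>

lemma block_Neyman_Pearson:
  assumes f: "density_family f" and T: "likelihood_ratio_test f b a T"
    and U: "U \<subseteq> {1..n}" "\<And>i. i \<in> U \<Longrightarrow> \<theta> i = b"
    and A: "\<And>i. i \<in> U \<Longrightarrow> A i \<in> sets (\<Pi>\<^sub>M i\<in>{1..n}. borel)"
    and k: "\<And>x. x \<in> {1..n} \<rightarrow>\<^sub>E UNIV \<Longrightarrow> (\<Sum>i\<in>U. indicator (A i) x) \<le> k"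
      "k \<le> real (card U) * measure (signal_law f b) T"
  shows "(\<Sum>i\<in>U. measure (obs_law f n (\<theta>(i := a))) (A i)) \<le> real (card U) * measure (signal_law f a) T"
proof -
  obtain r c where r [measurable]: "r \<in> borel_measurable borel"
    and ra: "signal_law f a = density (signal_law f b) (\<lambda>x. ennreal (r x))"
    and c: "0 \<le> c" "\<And>x. x \<in> T \<Longrightarrow> c \<le> r x" "\<And>x. x \<notin> T \<Longrightarrow> r x \<le> c"
    and [measurable]: "T \<in> sets borel"
    using T unfolding likelihood_ratio_test_def by blast
  interpret P: prob_space "obs_law f n \<eta>" for \<eta> using f by (rule prob_space_obs_law)
  interpret Q: prob_space "signal_law f e" for e using f by (rule prob_space_signal_law)
  have fin: "finite U" using U(1) finite_subset by blast
  have A' [measurable]: "A i \<in> sets (obs_law f n \<theta>)" if "i \<in> U" for i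
    using A that by (simp add: sets_obs_law)
  have comp: "(\<lambda>x. x i) \<in> borel_measurable (obs_law f n \<theta>)" if "i \<in> U" for i
    unfolding measurable_obs_law using U(1) that by (intro measurable_component_singleton) auto
  have upd: "\<theta>(i := b) = \<theta>" if "i \<in> U" for i using U(2)[OF that] by (simp add: fun_upd_idem_iff)
  have meas_r: "(\<lambda>x. ennreal (r (x i))) \<in> borel_measurable (obs_law f n \<theta>)" if "i \<in> U" for i
    using comp[OF that] by measurable
  have meas_T: "(\<lambda>x. indicator T (x i) :: ennreal) \<in> borel_measurable (obs_law f n \<theta>)" if "i \<in> U" for i
    using comp[OF that] by measurable
  have meas_A: "(\<lambda>x. indicator (A i) x :: ennreal) \<in> borel_measurable (obs_law f n \<theta>)" if "i \<in> U" for i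
    using A'[OF that] by measurable
  note borel_measurable_times_ennreal [intro!]
  have T': "(\<integral>\<^sup>+x. indicator T (x i) \<partial>obs_law f n \<theta>') = emeasure (signal_law f (\<theta>' i)) T"
    if "i \<in> U" for i \<theta>'
  proof -
    have "(\<integral>\<^sup>+x. indicator T (x i) \<partial>obs_law f n \<theta>')
        = (\<integral>\<^sup>+x. indicator {x \<in> space (obs_law f n \<theta>'). x i \<in> T} x \<partial>obs_law f n \<theta>')"
      by (intro nn_integral_cong) (auto simp: indicator_def)
    also have "\<dots> = emeasure (obs_law f n \<theta>') {x \<in> space (obs_law f n \<theta>'). x i \<in> T}"
    proof (rule nn_integral_indicator)
      have "(\<lambda>x. x i) \<in> borel_measurable (obs_law f n \<theta>')"
        unfolding measurable_obs_law using U(1) that by (intro measurable_component_singleton) auto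
      then show "{x \<in> space (obs_law f n \<theta>'). x i \<in> T} \<in> sets (obs_law f n \<theta>')" by measurable
    qed
    also have "\<dots> = emeasure (signal_law f (\<theta>' i)) T"
      using U(1) that by (intro emeasure_obs_law_component[OF f]) auto
    finally show ?thesis .
  qed
  have mA: "emeasure (obs_law f n (\<theta>(i := a))) (A i) = (\<integral>\<^sup>+x. ennreal (r (x i)) * indicator (A i) x \<partial>obs_law f n \<theta>)"
    if "i \<in> U" for i
  proof -
    have "emeasure (obs_law f n (\<theta>(i := a))) (A i) = (\<integral>\<^sup>+x. indicator (A i) x \<partial>obs_law f n (\<theta>(i := a)))"
      using A[OF that] by (intro nn_integral_indicator[symmetric]) (simp add: sets_obs_law)
    also have "\<dots> = (\<integral>\<^sup>+x. ennreal (r (x i)) * indicator (A i) x \<partial>obs_law f n (\<theta>(i := b)))"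
      using U(1) that A[OF that] by (intro nn_integral_obs_law_upd[OF f _ ra]) auto
    finally show ?thesis by (simp add: upd[OF that])
  qed
  have mT: "emeasure (signal_law f a) T = (\<integral>\<^sup>+x. ennreal (r (x i)) * indicator T (x i) \<partial>obs_law f n \<theta>)"
    if "i \<in> U" for i
  proof -
    have "(\<lambda>x. indicator T (x i) :: ennreal) \<in> borel_measurable (\<Pi>\<^sub>M i\<in>{1..n}. borel)"
      using meas_T[OF that] by (simp only: measurable_obs_law)
    then have "(\<integral>\<^sup>+x. indicator T (x i) \<partial>obs_law f n (\<theta>(i := a)))
        = (\<integral>\<^sup>+x. ennreal (r (x i)) * indicator T (x i) \<partial>obs_law f n (\<theta>(i := b)))"
      using U(1) that by (intro nn_integral_obs_law_upd[OF f _ ra]) auto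
    then show ?thesis using T'[OF that, of "\<theta>(i := a)"] by (simp add: upd[OF that])
  qed
  \<comment> \<open>\<open>r (x i) - c\<close> is nonnegative on \<open>T\<close> and nonpositive
    off it; the inequality is arranged without subtraction because the integrals live in
    \<open>ennreal\<close>.\<close>
  have pw: "ennreal (r (x i)) * indicator (A i) x + ennreal c * indicator T (x i)
      \<le> ennreal (r (x i)) * indicator T (x i) + ennreal c * indicator (A i) x" for x i
    using c(2)[of "x i"] c(3)[of "x i"] by (auto simp: indicator_def intro: ennreal_leI)
  have "(\<Sum>i\<in>U. emeasure (obs_law f n (\<theta>(i := a))) (A i)) + ennreal c * (\<Sum>i\<in>U. emeasure (signal_law f b) T)
      = (\<Sum>i\<in>U. (\<integral>\<^sup>+x. ennreal (r (x i)) * indicator (A i) x \<partial>obs_law f n \<theta>)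
           + ennreal c * (\<integral>\<^sup>+x. indicator T (x i) \<partial>obs_law f n \<theta>))"
    by (simp add: sum.distrib sum_distrib_left mA T' U(2) mult.left_commute)
  also have "\<dots> = (\<Sum>i\<in>U. \<integral>\<^sup>+x. ennreal (r (x i)) * indicator (A i) x + ennreal c * indicator T (x i) \<partial>obs_law f n \<theta>)"
    by (intro sum.cong refl) (subst nn_integral_add, auto simp: nn_integral_cmult meas_T meas_r meas_A)
  also have "\<dots> \<le> (\<Sum>i\<in>U. \<integral>\<^sup>+x. ennreal (r (x i)) * indicator T (x i) + ennreal c * indicator (A i) x \<partial>obs_law f n \<theta>)"
    by (intro sum_mono nn_integral_mono pw)
  also have "\<dots> = (\<Sum>i\<in>U. (\<integral>\<^sup>+x. ennreal (r (x i)) * indicator T (x i) \<partial>obs_law f n \<theta>)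
           + ennreal c * (\<integral>\<^sup>+x. indicator (A i) x \<partial>obs_law f n \<theta>))"
    by (intro sum.cong refl) (subst nn_integral_add, auto simp: nn_integral_cmult meas_T meas_r meas_A)
  also have "\<dots> = (\<Sum>i\<in>U. emeasure (signal_law f a) T) + ennreal c * (\<Sum>i\<in>U. emeasure (obs_law f n \<theta>) (A i))"
    by (simp add: sum.distrib sum_distrib_left mT[symmetric])
  \<comment> \<open>All the measures are finite, so the inequality passes to the reals, where the
    \<open>c\<close> terms can be cancelled.\<close>
  finally have "ennreal ((\<Sum>i\<in>U. measure (obs_law f n (\<theta>(i := a))) (A i)) + c * (card U * measure (signal_law f b) T))
      \<le> ennreal (card U * measure (signal_law f a) T + c * (\<Sum>i\<in>U. measure (obs_law f n \<theta>) (A i)))"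
    using c(1) by (simp add: P.emeasure_eq_measure Q.emeasure_eq_measure sum_ennreal sum_nonneg ennreal_mult''
          ennreal_plus ennreal_mult' flip: ennreal_of_nat_eq_real_of_nat del: ennreal_le_iff)
  then have main: "(\<Sum>i\<in>U. measure (obs_law f n (\<theta>(i := a))) (A i)) + c * (card U * measure (signal_law f b) T)
      \<le> card U * measure (signal_law f a) T + c * (\<Sum>i\<in>U. measure (obs_law f n \<theta>) (A i))"
    using c(1) by (subst (asm) ennreal_le_iff) (auto intro!: add_nonneg_nonneg mult_nonneg_nonneg sum_nonneg)
  \<comment> \<open>Under the single law at \<open>\<theta>\<close> this sum is the expected number
    of events \<open>A i\<close> that occur, hence at most \<open>k\<close>.\<close>
  have "(\<Sum>i\<in>U. measure (obs_law f n \<theta>) (A i)) = (\<integral>x. (\<Sum>i\<in>U. indicator (A i) x) \<partial>obs_law f n \<theta>)"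
    using A' by (subst Bochner_Integration.integral_sum) (auto simp: P.emeasure_eq_measure)
  also have "\<dots> \<le> (\<integral>x. k \<partial>obs_law f n \<theta>)"
    using A' k(1) by (intro integral_mono) (auto simp: space_obs_law P.emeasure_eq_measure)
  also have "\<dots> = k" by (simp add: P.prob_space)
  finally have "c * (\<Sum>i\<in>U. measure (obs_law f n \<theta>) (A i)) \<le> c * (card U * measure (signal_law f b) T)"
    using k(2) c(1) by (intro mult_left_mono) auto
  with main show ?thesis by linarith
qed

section \<open>Tails of the signal laws\<close>

lemma Fcdf_eq_measure:
  assumes "density_family f"
  shows "Fcdf f a x = measure (signal_law f a) {..x}"
proof -
  have [measurable]: "f a \<in> borel_measurable borel" and nn: "\<And>t. 0 \<le> f a t"
    using assms by (auto simp: density_family_def)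
  have "Fcdf f a x = enn2real (\<integral>\<^sup>+t. ennreal (indicator {..x} t *\<^sub>R f a t) \<partial>lborel)"
    unfolding Fcdf_def set_lebesgue_integral_def using nn by (intro integral_eq_nn_integral) auto
  also have "(\<integral>\<^sup>+t. ennreal (indicator {..x} t *\<^sub>R f a t) \<partial>lborel)
      = (\<integral>\<^sup>+t. ennreal (f a t) * indicator {..x} t \<partial>lborel)"
    by (intro nn_integral_cong) (auto simp: indicator_def)
  also have "\<dots> = emeasure (signal_law f a) {..x}"
    by (simp add: signal_law_def emeasure_density)
  finally show ?thesis by (simp add: measure_def)
qed

lemma Fbar_eq_measure:
  assumes "density_family f"
  shows "Fbar f a x = measure (signal_law f a) {x<..}"
proof -
  interpret prob_space "signal_law f a" using assms by (rule prob_space_signal_law)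
  have "measure (signal_law f a) (UNIV - {..x}) = 1 - measure (signal_law f a) {..x}"
    using prob_compl[of "{..x}"] by simp
  moreover have "UNIV - {..x} = {x<..}" by auto
  ultimately show ?thesis using assms by (simp add: Fbar_def Fcdf_eq_measure)
qed

text \<open>Lebesgue measure is invariant under negation, and the substitution carries the density
  \<open>f b\<close> to \<open>f a\<close>.\<close>

lemma measure_signal_law_reflect:
  assumes f: "density_family f" and ab: "\<And>x. f b (- x) = f a x" and S: "S \<in> sets borel"
  shows "measure (signal_law f b) {x. - x \<in> S} = measure (signal_law f a) S"
proof -
  have fm [measurable]: "f c \<in> borel_measurable borel" for c
    using f by (auto simp: density_family_def)
  note [measurable] = S
  have "emeasure (signal_law f b) {x. - x \<in> S} = (\<integral>\<^sup>+x. ennreal (f b x) * indicator S (- x) \<partial>lborel)"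
    by (simp add: signal_law_def emeasure_density indicator_def)
  also have "\<dots> = (\<integral>\<^sup>+x. ennreal (f b x) * indicator S (- x) \<partial>distr lborel borel uminus)"
    by (simp add: lborel_distr_uminus)
  also have "\<dots> = (\<integral>\<^sup>+x. ennreal (f b (- x)) * indicator S x \<partial>lborel)"
    by (subst nn_integral_distr) auto
  also have "\<dots> = emeasure (signal_law f a) S"
    by (simp add: signal_law_def emeasure_density ab)
  finally show ?thesis by (simp add: measure_def)
qed

text \<open>The left half-line is reflected into an upper tail of the law \<open>b\<close>; the two
  half-lines are disjoint because \<open>0 \<le> t\<close>. The instances used are
  \<open>b = - a\<close> under the one-sided assumption and \<open>b = a\<close> for even
  densities.\<close>

lemma two_sided_tail:
  assumes f: "density_family f" and ab: "\<And>x. f b (- x) = f a x" and t: "0 \<le> t"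
  shows "measure (signal_law f a) {x. t < \<bar>x\<bar>} = Fbar f a t + Fbar f b t"
proof -
  interpret prob_space "signal_law f a" using f by (rule prob_space_signal_law)
  have ba: "f a (- x) = f b x" for x using ab[of "- x"] by simp
  have "{x. t < \<bar>x\<bar>} = {t<..} \<union> {x. - x \<in> {t<..}}" by (auto simp: abs_if)
  then have "measure (signal_law f a) {x. t < \<bar>x\<bar>}
      = measure (signal_law f a) {t<..} + measure (signal_law f a) {x. - x \<in> {t<..}}"
    using t by (simp, intro finite_measure_Union) auto
  then show ?thesis
    using measure_signal_law_reflect[OF f ba, where S="{t<..}"] f by (simp add: Fbar_eq_measure)
qed

section \<open>Tail regions as likelihood ratio tests\<close>

text \<open>The origin is a Lebesgue null set, so \<open>r\<close> may take any value there; the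
  two-sided test relies on this freedom.\<close>

lemma signal_law_ratio:
  assumes f: "density_family f" and pos: "\<And>x. 0 < f b x"
    and r: "\<And>x. x \<noteq> 0 \<Longrightarrow> r x = f a x / f b x" "r \<in> borel_measurable borel"
  shows "signal_law f a = density (signal_law f b) (\<lambda>x. ennreal (r x))"
proof -
  have fm [measurable]: "f c \<in> borel_measurable borel" and nn: "\<And>x. 0 \<le> f c x" for c
    using f by (auto simp: density_family_def)
  note [measurable] = r(2)
  have "density (signal_law f b) (\<lambda>x. ennreal (r x)) = density lborel (\<lambda>x. ennreal (f b x) * ennreal (r x))"
    unfolding signal_law_def by (rule density_density_eq) auto
  also have "\<dots> = density lborel (\<lambda>x. ennreal (f a x))"
  proof (rule density_cong)
    have "AE x in lborel. x \<noteq> (0::real)" by (rule AE_lborel_singleton)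
    then show "AE x in lborel. ennreal (f b x) * ennreal (r x) = ennreal (f a x)"
    proof eventually_elim
      case (elim x)
      then have "f b x * r x = f a x" using pos[of x] by (simp add: r(1))
      then show ?case using nn[of b x] by (simp flip: ennreal_mult')
    qed
  qed auto
  finally show ?thesis by (simp add: signal_law_def)
qed

text \<open>The cutoff is the ratio at \<open>t\<close> itself, which a nondecreasing ratio
  dominates to the left and is dominated by to the right.\<close>

lemma likelihood_ratio_test_upper_tail:
  assumes f: "density_family f" and pos: "\<And>x. 0 < f b x" and mono: "mono (\<lambda>x. f a x / f b x)"
  shows "likelihood_ratio_test f b a {t<..}"
proof -
  have fm [measurable]: "f c \<in> borel_measurable borel" and nn: "\<And>x. 0 \<le> f c x" for c
    using f by (auto simp: density_family_def)
  have "signal_law f a = density (signal_law f b) (\<lambda>x. ennreal (f a x / f b x))"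
    by (rule signal_law_ratio[where f=f]) (use f pos in auto)
  then show ?thesis
    unfolding likelihood_ratio_test_def
    using nn[of a t] pos[of t] monoD[OF mono]
    by (intro conjI exI[of _ "\<lambda>x. f a x / f b x"] exI[of _ "f a t / f b t"]) auto
qed

text \<open>Evenness of both densities makes the ratio a function of \<open>\<bar>x\<bar>\<close>,
  nondecreasing away from the origin, so its value at \<open>t\<close> separates the region from its
  complement.\<close>

lemma likelihood_ratio_test_two_sided:
  assumes f: "density_family f" and pos: "\<And>x. 0 < f b x" and mono: "mono_on {0<..} (\<lambda>x. f a x / f b x)"
    and even: "\<And>x. f a (- x) = f a x" "\<And>x. f b (- x) = f b x" and t: "0 < t"
  shows "likelihood_ratio_test f b a {x. t < \<bar>x\<bar>}"
proof -
  have fm [measurable]: "f c \<in> borel_measurable borel" and nn: "\<And>x. 0 \<le> f c x" for c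
    using f by (auto simp: density_family_def)
  \<comment> \<open>Monotonicity says nothing about the ratio at \<open>0\<close>, so its value there is changed.\<close>
  define r where "r x = (if x = 0 then 0 else f a x / f b x)" for x
  have rm: "r \<in> borel_measurable borel" unfolding r_def by measurable
  have r_abs: "r x = f a \<bar>x\<bar> / f b \<bar>x\<bar>" if "x \<noteq> 0" for x
    using that even by (auto simp: r_def abs_if)
  have "signal_law f a = density (signal_law f b) (\<lambda>x. ennreal (r x))"
    by (rule signal_law_ratio[OF f pos _ rm]) (simp add: r_def)
  moreover have "f a t / f b t \<le> r x" if "t < \<bar>x\<bar>" for x
    using mono_onD[OF mono, of t "\<bar>x\<bar>"] that t by (subst r_abs) auto
  \<comment> \<open>The origin lies outside the region, and the value \<open>0\<close> chosen there
    is below the nonnegative cutoff.\<close>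
  moreover have "r x \<le> f a t / f b t" if "\<not> t < \<bar>x\<bar>" for x
  proof (cases "x = 0")
    case False
    then show ?thesis using mono_onD[OF mono, of "\<bar>x\<bar>" t] that t by (subst r_abs) auto
  qed (use nn[of a t] pos[of t] in \<open>simp add: r_def\<close>)
  ultimately show ?thesis
    unfolding likelihood_ratio_test_def using nn[of a t] pos[of t] rm
    by (intro conjI exI[of _ r] exI[of _ "f a t / f b t"]) auto
qed

section \<open>Supports of the parameters and the false negative rate\<close>

text \<open>The chosen coordinates are nonzero because \<open>a\<close> is positive, and there are
  already \<open>s n\<close> of them; the sparsity constraint then leaves no room for
  others.\<close>

lemma Theta_support:
  assumes "\<theta> \<in> Theta a s n" "\<And>j. j \<in> {1..s n} \<Longrightarrow> 0 < a n j"
  obtains \<iota> where "inj_on \<iota> {1..s n}" "{i \<in> {1..n}. \<theta> i \<noteq> 0} = \<iota> ` {1..s n}"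
    "\<And>j. j \<in> {1..s n} \<Longrightarrow> a n j \<le> \<bar>\<theta> (\<iota> j)\<bar>"
proof -
  obtain \<iota> where i: "inj_on \<iota> {1..s n}" "\<iota> ` {1..s n} \<subseteq> {1..n}"
    "\<And>j. j \<in> {1..s n} \<Longrightarrow> a n j \<le> \<bar>\<theta> (\<iota> j)\<bar>"
    using assms(1) unfolding Theta_def by auto
  have "\<theta> (\<iota> j) \<noteq> 0" if "j \<in> {1..s n}" for j
    using assms(2)[OF that] i(3)[OF that] by auto
  then have sub: "\<iota> ` {1..s n} \<subseteq> {i \<in> {1..n}. \<theta> i \<noteq> 0}" using i(2) by auto
  have "card {i \<in> {1..n}. \<theta> i \<noteq> 0} \<le> card (\<iota> ` {1..s n})"
    using assms(1) i(1) by (simp add: Theta_def l0_ball_def card_image)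
  then have "\<iota> ` {1..s n} = {i \<in> {1..n}. \<theta> i \<noteq> 0}"
    by (intro card_seteq sub) auto
  with i that show thesis by auto
qed

lemma testing_procedure_event:
  assumes "testing_procedure \<phi>" "i \<in> {1..n}"
  shows "{x \<in> space (obs_law f n \<theta>). \<phi> n x i} \<in> sets (obs_law f n \<theta>)"
proof -
  have "(\<lambda>x. \<phi> n x i) \<in> measurable (obs_law f n \<theta>) (count_space UNIV)"
    using assms by (simp add: testing_procedure_def measurable_obs_law)
  then show ?thesis by measurable
qed

text \<open>The support has exactly \<open>k \<ge> 1\<close> elements, so the denominator is the
  constant \<open>k\<close> and the risk is one minus the average power over the signals.\<close>

lemma FNR_support:
  assumes f: "density_family f" and \<phi>: "testing_procedure \<phi>"
    and \<iota>: "inj_on \<iota> {1..k}" "{i \<in> {1..n}. \<theta> i \<noteq> 0} = \<iota> ` {1..k}" and k: "1 \<le> k"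
  shows "FNR f \<phi> n \<theta> = 1 - (\<Sum>j=1..k. measure (obs_law f n \<theta>) {x \<in> space (obs_law f n \<theta>). \<phi> n x (\<iota> j)}) / real k"
proof -
  let ?P = "obs_law f n \<theta>"
  let ?E = "\<lambda>i. {x \<in> space ?P. \<phi> n x i}"
  interpret prob_space ?P using f by (rule prob_space_obs_law)
  have E: "?E (\<iota> j) \<in> sets ?P" if "j \<in> {1..k}" for j
  proof -
    have "\<iota> j \<in> {1..n}" using \<iota>(2) that by blast
    then show ?thesis using \<phi> by (rule testing_procedure_event[rotated])
  qed
  \<comment> \<open>Applied to the numerator as it stands, and with \<open>g\<close> constantly
    \<open>1\<close> to the denominator.\<close>
  have red: "(\<Sum>i=1..n. of_bool (\<theta> i \<noteq> 0) * g i) = (\<Sum>j=1..k. g (\<iota> j))" for g :: "nat \<Rightarrow> real"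
  proof -
    have "(\<Sum>i=1..n. of_bool (\<theta> i \<noteq> 0) * g i) = (\<Sum>i\<in>{i \<in> {1..n}. \<theta> i \<noteq> 0}. g i)"
      by (intro sum.mono_neutral_cong_right) auto
    also have "\<dots> = (\<Sum>j=1..k. g (\<iota> j))" unfolding \<iota>(2) using \<iota>(1) by (simp add: sum.reindex)
    finally show ?thesis .
  qed
  have "FNR f \<phi> n \<theta> = (\<integral>x. (\<Sum>j=1..k. 1 - of_bool (\<phi> n x (\<iota> j))) / real k \<partial>?P)"
    unfolding FNR_def red using red[of "\<lambda>_. 1"] k by (simp add: max_def)
  also have "\<dots> = (\<integral>x. (\<Sum>j=1..k. 1 - indicator (?E (\<iota> j)) x) / real k \<partial>?P)"
    by (intro Bochner_Integration.integral_cong refl) (simp add: indicator_def)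
  also have "\<dots> = (\<Sum>j=1..k. (\<integral>x. 1 - indicator (?E (\<iota> j)) x \<partial>?P)) / real k"
    using E by (subst Bochner_Integration.integral_divide_zero, subst Bochner_Integration.integral_sum)
      (auto intro!: integrable_real_indicator simp: emeasure_eq_measure)
  also have "\<dots> = (\<Sum>j=1..k. 1 - prob (?E (\<iota> j))) / real k"
  proof -
    have "(\<integral>x. 1 - indicator (?E (\<iota> j)) x \<partial>?P) = 1 - prob (?E (\<iota> j))" if "j \<in> {1..k}" for j
      using E[OF that] by (subst Bochner_Integration.integral_diff)
        (auto intro!: integrable_real_indicator simp: emeasure_eq_measure prob_space)
    then show ?thesis by simp
  qed
  also have "\<dots> = 1 - (\<Sum>j=1..k. prob (?E (\<iota> j))) / real k"
    using k by (simp add: sum_subtractf diff_divide_distrib)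
  finally show ?thesis .
qed

section \<open>Averaging over placements of one signal per block\<close>

text \<open>Isolates the position of signal \<open>j\<close> while the others stay fixed, so that
  the Neyman-Pearson bound can be applied inside block \<open>j\<close>.\<close>

lemma sum_PiE_remove:
  assumes "j \<in> J" "finite J"
  shows "(\<Sum>\<iota>\<in>PiE J U. h \<iota>) = (\<Sum>g\<in>PiE (J - {j}) U. \<Sum>y\<in>U j. h (g(j := y)))"
proof -
  have J: "J = insert j (J - {j})" using assms(1) by auto
  have "PiE J U = (\<lambda>(y, g). g(j := y)) ` (U j \<times> PiE (J - {j}) U)"
    by (subst J) (rule PiE_insert_eq)
  moreover have "inj_on (\<lambda>(y, g). g(j := y)) (U j \<times> PiE (J - {j}) U)"
    by (rule inj_combinator) simp
  ultimately have "(\<Sum>\<iota>\<in>PiE J U. h \<iota>) = (\<Sum>(y, g)\<in>U j \<times> PiE (J - {j}) U. h (g(j := y)))"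
    by (simp only: sum.reindex) (simp add: case_prod_unfold o_def)
  also have "\<dots> = (\<Sum>y\<in>U j. \<Sum>g\<in>PiE (J - {j}) U. h (g(j := y)))"
    by (rule sum.cartesian_product[symmetric])
  also have "\<dots> = (\<Sum>g\<in>PiE (J - {j}) U. \<Sum>y\<in>U j. h (g(j := y)))"
    by (rule sum.swap)
  finally show ?thesis .
qed

text \<open>The worst risk \<open>R\<close> is at least the average risk over all placements. On the
  right stand the average power of the test \<open>T\<close>, the probability of exceeding the
  rejection budget, and the share of blocks with more than \<open>k\<close> rejections that the
  budget permits.\<close>

lemma FNR_lower_bound:
  fixes a :: "nat \<Rightarrow> nat \<Rightarrow> real" and s :: "nat \<Rightarrow> nat" and n :: nat
  defines "m \<equiv> n div s n"
  assumes f: "density_family f" and \<phi>: "testing_procedure \<phi>"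
    and s: "1 \<le> s n" and apos: "\<And>j. j \<in> {1..s n} \<Longrightarrow> 0 < a n j"
    and T: "\<And>j. j \<in> {1..s n} \<Longrightarrow> likelihood_ratio_test f 0 (a n j) T"
    and k: "0 < k" "k \<le> real m * measure (signal_law f 0) T"
    and B: "0 \<le> B"
    and R: "\<And>\<theta>. \<theta> \<in> Theta a s n \<Longrightarrow> FNR f \<phi> n \<theta> \<le> R"
    and p: "\<And>\<theta>. \<theta> \<in> Theta a s n \<Longrightarrow> measure (obs_law f n \<theta>)
        {x \<in> space (obs_law f n \<theta>). (\<Sum>i=1..n. of_bool (\<phi> n x i)) > B * real (s n)} \<le> p"
  shows "1 - R \<le> (\<Sum>j=1..s n. measure (signal_law f (a n j)) T) / real (s n) + p + B / k"
proof -
  define N where "N = s n"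
  define J where "J = {1..N}"
  \<comment> \<open>Block \<open>1\<close> starts at coordinate \<open>1\<close>, and
    \<open>N * m \<le> n\<close> keeps all blocks inside \<open>{1..n}\<close>; coordinates past
    \<open>N * m\<close> never carry a signal.\<close>
  define U where "U j = {(j - 1) * m<..j * m}" for j
  define C where "C = PiE J U"
  \<comment> \<open>For a placement in \<open>C\<close> at most one summand is nonzero, since the
    blocks are disjoint. Written as a sum, the configuration splits easily into signal
    \<open>j\<close> and the rest.\<close>
  define \<theta> where "\<theta> \<iota> = restrict (\<lambda>i. \<Sum>j\<in>J. if \<iota> j = i then a n j else 0) {1..n}" for \<iota>
  define K where "K j x = (\<Sum>i\<in>U j. of_bool (\<phi> n x i) :: real)" for j x
  define q where "q j = measure (signal_law f (a n j)) T" for j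
  \<comment> \<open>With \<open>m = 0\<close> the upper bound on \<open>k\<close> would force
    \<open>k \<le> 0\<close>.\<close>
  have m: "1 \<le> m" using k by (cases m) auto
  have finJ [simp]: "finite J" and finU [simp]: "finite (U j)" for j by (auto simp: J_def U_def)
  have cardU: "card (U j) = m" if "j \<in> J" for j
    using that by (cases j) (auto simp: U_def J_def)
  have Un: "U j \<subseteq> {1..n}" if "j \<in> J" for j
  proof -
    have "j * m \<le> N * m" using that by (simp add: J_def)
    also have "\<dots> \<le> n" by (simp add: m_def N_def)
    finally show ?thesis by (auto simp: U_def)
  qed
  have Udisj: "U i \<inter> U j = {}" if "i < j" for i j
  proof -
    have "i * m \<le> (j - 1) * m" using that by (intro mult_right_mono) auto
    then show ?thesis by (auto simp: U_def)
  qed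
  have Ueq: "i = j" if "y \<in> U i" "y \<in> U j" for i j y
    using that Udisj[of i j] Udisj[of j i] by (cases i j rule: linorder_cases) auto
  have finC: "finite C" unfolding C_def by (intro finite_PiE) auto
  have cardC: "card C = m * card (PiE (J - {j}) U)" if "j \<in> J" for j
    unfolding C_def using that cardU prod.remove[OF finJ that, of "\<lambda>j. card (U j)"] by (simp add: card_PiE)
  have "card C = m ^ N" unfolding C_def using cardU by (simp add: card_PiE J_def)
  then have M: "0 < card C" using m by simp
  have \<theta>_Theta: "\<theta> \<iota> \<in> Theta a s n" and \<iota>_inj: "inj_on \<iota> J" and \<iota>_supp: "{i \<in> {1..n}. \<theta> \<iota> i \<noteq> 0} = \<iota> ` J"
    and \<iota>_n: "\<iota> ` J \<subseteq> {1..n}" if "\<iota> \<in> C" for \<iota>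
  proof -
    have \<iota>U: "\<iota> j \<in> U j" if "j \<in> J" for j using that \<open>\<iota> \<in> C\<close> by (auto simp: C_def)
    show inj: "inj_on \<iota> J" using \<iota>U Ueq by (metis inj_onI)
    show sub: "\<iota> ` J \<subseteq> {1..n}" using \<iota>U Un by blast
    have val: "\<theta> \<iota> (\<iota> j) = a n j" if "j \<in> J" for j
    proof -
      have "\<iota> j \<in> {1..n}" using sub that by auto
      then have "\<theta> \<iota> (\<iota> j) = (\<Sum>j'\<in>J. if \<iota> j' = \<iota> j then a n j' else 0)" by (simp add: \<theta>_def)
      also have "\<dots> = (\<Sum>j'\<in>J. if j' = j then a n j' else 0)"
        using inj that by (intro sum.cong) (auto simp: inj_on_eq_iff)
      also have "\<dots> = a n j" using that by simp
      finally show ?thesis .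
    qed
    have "\<theta> \<iota> i = 0" if "i \<in> {1..n}" "i \<notin> \<iota> ` J" for i
      using that by (auto simp: \<theta>_def intro!: sum.neutral)
    moreover have "\<theta> \<iota> (\<iota> j) \<noteq> 0" if "j \<in> J" for j
      using val[OF that] apos[of j] that by (auto simp: J_def N_def)
    ultimately show supp: "{i \<in> {1..n}. \<theta> \<iota> i \<noteq> 0} = \<iota> ` J" using sub by blast
    have "card {i \<in> {1..n}. \<theta> \<iota> i \<noteq> 0} \<le> s n"
      unfolding supp card_image[OF inj] by (simp add: J_def N_def)
    then have "\<theta> \<iota> \<in> l0_ball n (s n)" by (simp add: l0_ball_def \<theta>_def)
    then show "\<theta> \<iota> \<in> Theta a s n"
      unfolding Theta_def using inj sub val by (auto simp: J_def N_def intro!: exI[of _ \<iota>])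
  qed
  interpret prob_space "obs_law f n \<eta>" for \<eta> using f by (rule prob_space_obs_law)
  define X where "X = ({1..n} \<rightarrow>\<^sub>E UNIV :: (nat \<Rightarrow> real) set)"
  have space: "space (obs_law f n \<eta>) = X" for \<eta> by (simp add: space_obs_law X_def)
  have ev [measurable]: "{x \<in> X. \<phi> n x i} \<in> sets (obs_law f n \<eta>)" if "i \<in> {1..n}" for i \<eta>
    using testing_procedure_event[OF \<phi> that, of f \<eta>] by (simp add: space)
  have \<phi>m: "(\<lambda>x. of_bool (\<phi> n x i) :: real) \<in> borel_measurable (obs_law f n \<eta>)" if "i \<in> {1..n}" for i \<eta>
  proof -
    have "(\<lambda>x. indicator {x \<in> X. \<phi> n x i} x :: real) \<in> borel_measurable (obs_law f n \<eta>)"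
      using ev[OF that] by measurable
    then show ?thesis
      by (rule measurable_cong[THEN iffD1, rotated]) (auto simp: space indicator_def)
  qed
  have Km: "K j \<in> borel_measurable (obs_law f n \<eta>)" if "j \<in> J" for j \<eta>
    unfolding K_def using Un[OF that] by (intro borel_measurable_sum \<phi>m) auto
  have Km': "{x \<in> X. K j x \<le> k} \<in> sets (obs_law f n \<eta>)" "{x \<in> X. k < K j x} \<in> sets (obs_law f n \<eta>)"
    if "j \<in> J" for j \<eta>
    using Km[OF that, of \<eta>] unfolding space[of \<eta>, symmetric] by measurable
  \<comment> \<open>A rejection counts only while its block holds at most \<open>k\<close>
    rejections; this truncation is what gives the cap required by
    \<open>block_Neyman_Pearson\<close>.\<close>
  define A where "A j i = {x \<in> X. \<phi> n x i} \<inter> {x \<in> X. K j x \<le> k}" for j i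
  have Am: "A j i \<in> sets (obs_law f n \<eta>)" if "j \<in> J" "i \<in> {1..n}" for i j \<eta>
    unfolding A_def using that by (intro sets.Int ev Km')
  have hit: "(\<Sum>\<iota>\<in>C. measure (obs_law f n (\<theta> \<iota>)) (A j (\<iota> j))) \<le> real (card C) * q j" if j: "j \<in> J" for j
  proof -
    have "(\<Sum>\<iota>\<in>C. measure (obs_law f n (\<theta> \<iota>)) (A j (\<iota> j)))
        = (\<Sum>g\<in>PiE (J - {j}) U. \<Sum>y\<in>U j. measure (obs_law f n (\<theta> (g(j := y)))) (A j y))"
      unfolding C_def by (subst sum_PiE_remove[OF j]) auto
    also have "\<dots> \<le> (\<Sum>g\<in>PiE (J - {j}) U. real m * q j)"
    proof (rule sum_mono)
      fix g assume g: "g \<in> PiE (J - {j}) U"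
      \<comment> \<open>The configuration with block \<open>j\<close> emptied. It need not be
        extensional, because \<open>obs_law\<close> looks only at coordinates in
        \<open>{1..n}\<close>.\<close>
      define \<eta> where "\<eta> i = (\<Sum>j'\<in>J - {j}. if g j' = i then a n j' else 0)" for i
      have \<eta>0: "\<eta> i = 0" if "i \<in> U j" for i
        unfolding \<eta>_def
      proof (intro sum.neutral ballI)
        fix j' assume j': "j' \<in> J - {j}"
        then have "g j' \<in> U j'" using g by auto
        then have "g j' \<noteq> i" using that Ueq[of i j j'] j' by auto
        then show "(if g j' = i then a n j' else 0) = 0" by simp
      qed
      have "obs_law f n (\<theta> (g(j := y))) = obs_law f n (\<eta>(y := a n j))" if y: "y \<in> U j" for y
      proof (rule obs_law_cong)
        fix i assume "i \<in> {1..n}"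
        then have "\<theta> (g(j := y)) i = (if y = i then a n j else 0) + \<eta> i"
          by (simp add: \<theta>_def \<eta>_def sum.remove[OF finJ j])
        then show "\<theta> (g(j := y)) i = (\<eta>(y := a n j)) i" using \<eta>0[OF y] by auto
      qed
      then have "(\<Sum>y\<in>U j. measure (obs_law f n (\<theta> (g(j := y)))) (A j y))
          = (\<Sum>y\<in>U j. measure (obs_law f n (\<eta>(y := a n j))) (A j y))" by simp
      also have "\<dots> \<le> real (card (U j)) * measure (signal_law f (a n j)) T"
      proof (rule block_Neyman_Pearson[OF f, where b=0 and k=k])
        show "likelihood_ratio_test f 0 (a n j) T" using T j by (simp add: J_def N_def)
        show "A j i \<in> sets (\<Pi>\<^sub>M i\<in>{1..n}. borel)" if "i \<in> U j" for i
          \<comment> \<open>The sigma-algebra is the same for every parameter, so an arbitrary one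
            is inserted.\<close>
          using Am[OF j, of i undefined] Un[OF j] that by (auto simp: sets_obs_law)
        show "(\<Sum>i\<in>U j. indicator (A j i) x) \<le> k" if x: "x \<in> {1..n} \<rightarrow>\<^sub>E UNIV" for x
        proof (cases "K j x \<le> k")
          case True
          then have "(\<Sum>i\<in>U j. indicator (A j i) x) = K j x"
            unfolding K_def using x by (intro sum.cong) (auto simp: A_def X_def indicator_def K_def)
          with True show ?thesis by simp
        next
          \<comment> \<open>In an overfull block every \<open>A j i\<close> fails, so the sum is
            \<open>0\<close>.\<close>
          case False
          then show ?thesis using k(1) by (simp add: A_def)
        qed
        show "k \<le> real (card (U j)) * measure (signal_law f 0) T" using k(2) cardU[OF j] by simp
      qed (use Un[OF j] \<eta>0 in auto)
      finally show "(\<Sum>y\<in>U j. measure (obs_law f n (\<theta> (g(j := y)))) (A j y)) \<le> real m * q j"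
        using cardU[OF j] by (simp add: q_def)
    qed
    also have "\<dots> = real (card C) * q j" using cardC[OF j] by simp
    finally show ?thesis .
  qed
  have overfull: "(\<Sum>j\<in>J. measure (obs_law f n (\<theta> \<iota>)) {x \<in> X. k < K j x}) \<le> real N * (p + B / k)"
    if \<iota>: "\<iota> \<in> C" for \<iota>
  proof -
    let ?P = "obs_law f n (\<theta> \<iota>)"
    define D where "D = {x \<in> X. (\<Sum>i=1..n. of_bool (\<phi> n x i)) > B * real N}"
    have "(\<lambda>x. \<Sum>i=1..n. of_bool (\<phi> n x i) :: real) \<in> borel_measurable ?P"
      by (intro borel_measurable_sum \<phi>m)
    then have Dm: "D \<in> sets ?P" unfolding D_def space[of "\<theta> \<iota>", symmetric] by measurable
    \<comment> \<open>On \<open>D\<close> the number of overfull blocks is bounded by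
      \<open>N\<close>. Off \<open>D\<close> there are at most \<open>B * N\<close> rejections, and
      each overfull block uses more than \<open>k\<close> of them, the blocks being
      disjoint.\<close>
    have pw: "(\<Sum>j\<in>J. indicator {x \<in> X. k < K j x} x) \<le> real N * indicator D x + real N * (B / k)"
      if x: "x \<in> X" for x
    proof (cases "x \<in> D")
      case True
      have "(\<Sum>j\<in>J. indicator {x \<in> X. k < K j x} x :: real) \<le> (\<Sum>j\<in>J. 1)"
        by (intro sum_mono) (auto simp: indicator_def)
      then show ?thesis using True B k(1) by (simp add: J_def add_increasing2)
    next
      case False
      have "k * (\<Sum>j\<in>J. indicator {x \<in> X. k < K j x} x) \<le> (\<Sum>j\<in>J. K j x)"
        unfolding sum_distrib_left using k(1)
        by (intro sum_mono) (auto simp: indicator_def K_def intro: sum_nonneg)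
      also have "\<dots> = (\<Sum>i\<in>(\<Union>j\<in>J. U j). of_bool (\<phi> n x i))"
        unfolding K_def using Ueq by (intro sum.UNION_disjoint[symmetric]) auto
      also have "\<dots> \<le> (\<Sum>i=1..n. of_bool (\<phi> n x i))"
        using Un by (intro sum_mono2) auto
      also have "\<dots> \<le> B * real N" using False x by (simp add: D_def)
      finally have "(\<Sum>j\<in>J. indicator {x \<in> X. k < K j x} x) \<le> B * real N / k"
        using k(1) by (simp add: field_simps)
      then show ?thesis using False by (simp add: mult.commute)
    qed
    have "(\<Sum>j\<in>J. prob (\<theta> \<iota>) {x \<in> X. k < K j x}) = (\<integral>x. (\<Sum>j\<in>J. indicator {x \<in> X. k < K j x} x) \<partial>?P)"
      using Km' by (subst Bochner_Integration.integral_sum) (auto simp: emeasure_eq_measure)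
    also have "\<dots> \<le> (\<integral>x. real N * indicator D x + real N * (B / k) \<partial>?P)"
      using Km' Dm pw by (intro integral_mono Bochner_Integration.integrable_sum Bochner_Integration.integrable_add
        integrable_mult_right integrable_real_indicator)
        (auto simp: emeasure_eq_measure space)
    also have "\<dots> = real N * prob (\<theta> \<iota>) D + real N * (B / k)"
      using Dm by (subst Bochner_Integration.integral_add) (auto simp: emeasure_eq_measure prob_space)
    also have "\<dots> \<le> real N * p + real N * (B / k)"
      using p[OF \<theta>_Theta[OF \<iota>]] by (intro add_right_mono mult_left_mono) (auto simp: D_def N_def space)
    finally show ?thesis by (simp add: algebra_simps)
  qed
  have lower: "real N * (1 - R) \<le> (\<Sum>j\<in>J. measure (obs_law f n (\<theta> \<iota>)) (A j (\<iota> j))) + real N * (p + B / k)"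
    if \<iota>: "\<iota> \<in> C" for \<iota>
  proof -
    let ?P = "obs_law f n (\<theta> \<iota>)"
    have "FNR f \<phi> n (\<theta> \<iota>) = 1 - (\<Sum>j=1..N. prob (\<theta> \<iota>) {x \<in> space ?P. \<phi> n x (\<iota> j)}) / real N"
      using \<iota>_inj[OF \<iota>] \<iota>_supp[OF \<iota>] s by (intro FNR_support[OF f \<phi>]) (auto simp: J_def N_def)
    then have "1 - (\<Sum>j\<in>J. prob (\<theta> \<iota>) {x \<in> X. \<phi> n x (\<iota> j)}) / real N \<le> R"
      using R[OF \<theta>_Theta[OF \<iota>]] by (simp add: J_def space)
    then have "real N * (1 - R) \<le> (\<Sum>j\<in>J. prob (\<theta> \<iota>) {x \<in> X. \<phi> n x (\<iota> j)})"
      using s by (simp add: N_def field_simps)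
    \<comment> \<open>A detected signal is either a truncated rejection or sits in an overfull
      block.\<close>
    also have "\<dots> \<le> (\<Sum>j\<in>J. prob (\<theta> \<iota>) (A j (\<iota> j)) + prob (\<theta> \<iota>) {x \<in> X. k < K j x})"
    proof (rule sum_mono)
      fix j assume j: "j \<in> J"
      then have ij: "\<iota> j \<in> {1..n}" using \<iota>_n[OF \<iota>] by auto
      have "prob (\<theta> \<iota>) {x \<in> X. \<phi> n x (\<iota> j)} \<le> prob (\<theta> \<iota>) (A j (\<iota> j) \<union> {x \<in> X. k < K j x})"
        by (rule finite_measure_mono) (use Am[OF j ij] Km'[OF j] in \<open>auto simp: A_def\<close>)
      also have "\<dots> \<le> prob (\<theta> \<iota>) (A j (\<iota> j)) + prob (\<theta> \<iota>) {x \<in> X. k < K j x}"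
        by (rule measure_Un_le) (use Am[OF j ij] Km'[OF j] in auto)
      finally show "prob (\<theta> \<iota>) {x \<in> X. \<phi> n x (\<iota> j)} \<le> \<dots>" .
    qed
    also have "\<dots> \<le> (\<Sum>j\<in>J. prob (\<theta> \<iota>) (A j (\<iota> j))) + real N * (p + B / k)"
      using overfull[OF \<iota>] by (simp add: sum.distrib)
    finally show ?thesis .
  qed
  \<comment> \<open>Sum over all placements and exchange the sums, so that \<open>hit\<close>
    applies block by block; division by \<open>card C\<close> follows at the end.\<close>
  have "real (card C) * (real N * (1 - R)) = (\<Sum>\<iota>\<in>C. real N * (1 - R))" by simp
  also have "\<dots> \<le> (\<Sum>\<iota>\<in>C. (\<Sum>j\<in>J. prob (\<theta> \<iota>) (A j (\<iota> j))) + real N * (p + B / k))"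
    by (rule sum_mono) (rule lower)
  also have "\<dots> = (\<Sum>j\<in>J. \<Sum>\<iota>\<in>C. prob (\<theta> \<iota>) (A j (\<iota> j))) + real (card C) * (real N * (p + B / k))"
    by (subst sum.swap) (simp add: sum.distrib)
  also have "\<dots> \<le> (\<Sum>j\<in>J. real (card C) * q j) + real (card C) * (real N * (p + B / k))"
    by (intro add_right_mono sum_mono hit)
  also have "\<dots> = real (card C) * ((\<Sum>j\<in>J. q j) + real N * (p + B / k))"
    by (simp add: sum_distrib_left distrib_left)
  finally have "real N * (1 - R) \<le> (\<Sum>j\<in>J. q j) + real N * (p + B / k)"
    using M by (simp add: mult_le_cancel_left)
  moreover have "0 < real N" using s by (simp add: N_def)
  ultimately have "1 - R \<le> (\<Sum>j\<in>J. q j) / real N + (p + B / k)"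
    by (simp add: field_simps)
  then show ?thesis by (simp add: q_def J_def N_def)
qed

section \<open>The lower bound with a vanishing remainder\<close>

text \<open>At the finitely many exceptional \<open>n\<close> the remainder is set to the exact gap,
  which does not affect its limit.\<close>

lemma le_up_to_o1I:
  assumes le: "\<forall>\<^sub>F n in sequentially. u n \<le> v n + e n" and e: "e \<longlonglongrightarrow> 0"
  shows "le_up_to_o1 u v"
proof -
  define e' where "e' n = (if u n \<le> v n + e n then e n else u n - v n)" for n
  have "\<forall>\<^sub>F n in sequentially. e' n = e n"
    using le by eventually_elim (simp add: e'_def)
  then have "e' \<longlonglongrightarrow> 0" using e by (simp add: tendsto_cong)
  moreover have "u n \<le> v n + e' n" for n by (simp add: e'_def)
  ultimately show ?thesis unfolding le_up_to_o1_def by blast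
qed

text \<open>The signals are placed at the first \<open>s n\<close> coordinates. Nonemptiness is what
  gives the real suprema over \<open>Theta a s n\<close> a meaning.\<close>

lemma Theta_nonempty:
  assumes "s n \<le> n"
  shows "Theta a s n \<noteq> {}"
proof -
  define \<theta> where "\<theta> = restrict (\<lambda>i. if i \<le> s n then a n i else 0) {1..n}"
  have "{i \<in> {1..n}. \<theta> i \<noteq> 0} \<subseteq> {1..s n}" by (auto simp: \<theta>_def split: if_splits)
  then have "card {i \<in> {1..n}. \<theta> i \<noteq> 0} \<le> card {1..s n}" by (rule card_mono[rotated]) simp
  then have "\<theta> \<in> l0_ball n (s n)" by (simp add: l0_ball_def) (simp add: \<theta>_def)
  moreover have "a n j \<le> \<bar>\<theta> j\<bar>" if "j \<in> {1..s n}" for j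
    using that assms by (auto simp: \<theta>_def)
  ultimately have "\<theta> \<in> Theta a s n"
    using assms unfolding Theta_def by (auto intro!: exI[of _ id])
  then show ?thesis by auto
qed

text \<open>A real supremum bounds its set only if the set is bounded above; here \<open>1\<close>
  is a bound, by the formula for the risk on the support.\<close>

lemma sup_FNR_upper:
  assumes f: "density_family f" and \<phi>: "testing_procedure \<phi>" and s: "1 \<le> s n"
    and apos: "\<And>j. j \<in> {1..s n} \<Longrightarrow> 0 < a n j" and \<theta>: "\<theta> \<in> Theta a s n"
  shows "FNR f \<phi> n \<theta> \<le> sup_FNR f (Theta a s) \<phi> n"
proof -
  have "FNR f \<phi> n \<eta> \<le> 1" if \<eta>: "\<eta> \<in> Theta a s n" for \<eta>
  proof -
    obtain \<iota> where "inj_on \<iota> {1..s n}" "{i \<in> {1..n}. \<eta> i \<noteq> 0} = \<iota> ` {1..s n}"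
      using Theta_support[where a=a and s=s, OF \<eta> apos] by metis
    then show ?thesis
      using FNR_support[OF f \<phi> _ _ s] by (simp add: sum_nonneg)
  qed
  then have "bdd_above (FNR f \<phi> n ` Theta a s n)" by (intro bdd_aboveI[of _ 1]) auto
  then show ?thesis unfolding sup_FNR_def using \<theta> by (intro cSUP_upper)
qed

text \<open>Rounding down costs at most a factor \<open>2\<close>: the remainder is at most
  \<open>s\<close>, which is at most \<open>s * (n div s)\<close>.\<close>

lemma half_le_real_div:
  assumes "1 \<le> s" "s \<le> n"
  shows "real n / real s / 2 \<le> real (n div s)"
proof -
  have "n = s * (n div s) + n mod s" by simp
  then have "real n = real s * real (n div s) + real (n mod s)" by (metis of_nat_add of_nat_mult)
  moreover have "real (n mod s) \<le> real s" using assms by (simp add: less_imp_le)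
  moreover have "real s * 1 \<le> real s * real (n div s)"
    using assms div_le_mono[of s n s] by (intro mult_left_mono) auto
  ultimately have "real n \<le> 2 * (real s * real (n div s))" by linarith
  then show ?thesis using assms by (simp add: field_simps)
qed

text \<open>Serves both symmetry cases: \<open>T n\<close> is the one- or two-sided region at the
  lowered threshold, \<open>p n\<close> a lower bound for its null probability, \<open>w n j\<close>
  the power at \<open>astar\<close>, and \<open>d n\<close> the cost of moving the
  threshold.\<close>

lemma sparsity_preserving_lower_bound:
  assumes f: "density_family f" and \<phi>: "\<phi> \<in> sparsity_preserving_class f s (Theta a s) B"
    and s: "filterlim s at_top sequentially"
    and ns: "filterlim (\<lambda>n. real n / real (s n)) at_top sequentially"
    and apos: "\<And>n j. j \<in> {1..s n} \<Longrightarrow> 0 < a n j"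
    and B: "\<forall>\<^sub>F n in sequentially. 0 \<le> B n"
      "\<forall>\<^sub>F n in sequentially. (B n)\<^sup>2 \<le> 1 / 3 * (real n / real (s n)) * p n"
    and p: "filterlim (\<lambda>n. real n / real (s n) * p n) at_top sequentially"
      "\<forall>\<^sub>F n in sequentially. p n \<le> measure (signal_law f 0) (T n)"
    and T: "\<forall>\<^sub>F n in sequentially. \<forall>j\<in>{1..s n}. likelihood_ratio_test f 0 (a n j) (T n)"
    and w: "\<forall>\<^sub>F n in sequentially. \<forall>j\<in>{1..s n}. measure (signal_law f (a n j)) (T n) \<le> w n j + d n"
    and d: "d \<longlonglongrightarrow> 0"
  shows "le_up_to_o1 (\<lambda>n. 1 - (\<Sum>j=1..s n. w n j) / real (s n)) (sup_FNR f (Theta a s) \<phi>)"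
proof -
  define \<mu> where "\<mu> n = real n / real (s n) * p n" for n
  define W where "W n \<theta> = measure (obs_law f n \<theta>)
      {x \<in> space (obs_law f n \<theta>). (\<Sum>i=1..n. of_bool (\<phi> n x i)) > B n * real (s n)}" for n \<theta>
  define P where "P n = (SUP \<theta>\<in>Theta a s n. W n \<theta>)" for n
  have tp: "testing_procedure \<phi>" and P0: "P \<longlonglongrightarrow> 0"
    using \<phi> unfolding sparsity_preserving_class_def sparsity_preserving_def P_def[abs_def] W_def by blast+
  have W: "W n \<theta> \<le> P n" if "\<theta> \<in> Theta a s n" for n \<theta>
  proof -
    have "W n \<eta> \<le> 1" for \<eta>
      unfolding W_def using prob_space_obs_law[OF f] by (rule prob_space.prob_le_1)
    then have "bdd_above (W n ` Theta a s n)" by (intro bdd_aboveI[of _ 1]) auto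
    then show ?thesis unfolding P_def using that by (intro cSUP_upper)
  qed
  \<comment> \<open>This will bound \<open>B n / k\<close>: the numerator comes from the hypothesis
    on the square of \<open>B n\<close>, the denominator from the rounding loss in the block
    size.\<close>
  have "((\<lambda>x::real. sqrt (x / 3) / (x / 2)) \<longlongrightarrow> 0) at_top" by real_asymp
  then have \<mu>0: "(\<lambda>n. sqrt (\<mu> n / 3) / (\<mu> n / 2)) \<longlonglongrightarrow> 0"
    by (rule filterlim_compose) (use p(1) in \<open>simp add: \<mu>_def\<close>)
  show ?thesis
  proof (rule le_up_to_o1I)
    show "(\<lambda>n. d n + P n + sqrt (\<mu> n / 3) / (\<mu> n / 2)) \<longlonglongrightarrow> 0"
      using tendsto_add[OF tendsto_add[OF d P0] \<mu>0] by simp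
    have "\<forall>\<^sub>F n in sequentially. 1 \<le> s n" using s by (simp add: filterlim_at_top)
    moreover have "\<forall>\<^sub>F n in sequentially. 1 \<le> real n / real (s n)" using ns by (simp add: filterlim_at_top)
    moreover have "\<forall>\<^sub>F n in sequentially. 1 \<le> \<mu> n" using p(1) by (simp add: filterlim_at_top \<mu>_def)
    ultimately show "\<forall>\<^sub>F n in sequentially. 1 - (\<Sum>j=1..s n. w n j) / real (s n)
        \<le> sup_FNR f (Theta a s) \<phi> n + (d n + P n + sqrt (\<mu> n / 3) / (\<mu> n / 2))"
      using B p(2) T w
    proof eventually_elim
      case (elim n)
      let ?m = "n div s n"
      \<comment> \<open>The largest cap justified by \<open>p n\<close>: block size times a lower
        bound for the null probability of \<open>T n\<close>.\<close>
      define k where "k = real ?m * p n"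
      have sn: "s n \<le> n" using elim(1,2) by (simp add: field_simps)
      have "0 < real n / real (s n)" using elim(2) by linarith
      moreover have "0 < real n / real (s n) * p n" using elim(3) by (simp add: \<mu>_def)
      ultimately have pn: "0 < p n" by (simp only: zero_less_mult_iff) auto
      have "\<mu> n / 2 = real n / real (s n) / 2 * p n" by (simp add: \<mu>_def)
      also have "\<dots> \<le> k" unfolding k_def
        using half_le_real_div[OF elim(1) sn] pn by (intro mult_right_mono) auto
      finally have k: "\<mu> n / 2 \<le> k" .
      have "(B n)\<^sup>2 \<le> \<mu> n / 3" using elim(5) by (simp add: \<mu>_def)
      then have "B n \<le> sqrt (\<mu> n / 3)" by (rule real_le_rsqrt)
      then have Bk: "B n / k \<le> sqrt (\<mu> n / 3) / (\<mu> n / 2)"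
        using k elim(3,4) by (intro frac_le) auto
      have "1 - sup_FNR f (Theta a s) \<phi> n
          \<le> (\<Sum>j=1..s n. measure (signal_law f (a n j)) (T n)) / real (s n) + P n + B n / k"
      proof (rule FNR_lower_bound[where a=a and s=s and n=n, OF f tp elim(1), where T="T n" and B="B n"])
        show "0 < a n j" if "j \<in> {1..s n}" for j using apos[OF that] .
        show "likelihood_ratio_test f 0 (a n j) (T n)" if "j \<in> {1..s n}" for j using elim(7) that by blast
        show "0 < k" using k elim(3) by linarith
        show "k \<le> real ?m * measure (signal_law f 0) (T n)"
          unfolding k_def using elim(6) by (intro mult_left_mono) auto
        show "FNR f \<phi> n \<theta> \<le> sup_FNR f (Theta a s) \<phi> n" if "\<theta> \<in> Theta a s n" for \<theta>
          using sup_FNR_upper[where a=a and s=s, OF f tp elim(1) apos that] .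
      qed (use elim(4) W in \<open>auto simp: W_def\<close>)
      also have "(\<Sum>j=1..s n. measure (signal_law f (a n j)) (T n)) / real (s n)
          \<le> (\<Sum>j=1..s n. w n j + d n) / real (s n)"
        using elim(8) by (intro divide_right_mono sum_mono) auto
      also have "\<dots> = (\<Sum>j=1..s n. w n j) / real (s n) + d n"
        using elim(1) by (simp add: sum.distrib add_divide_distrib)
      finally show ?case using Bk by linarith
    qed
  qed
qed

section \<open>Thresholding: sparsity and risk\<close>

lemma testing_procedure_threshold: "testing_procedure (threshold_procedure t)"
  unfolding testing_procedure_def
proof (intro allI ballI)
  fix n i :: nat assume "i \<in> {1..n}"
  then have [measurable]: "(\<lambda>x. x i) \<in> borel_measurable (\<Pi>\<^sub>M i\<in>{1..n}. (borel :: real measure))"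
    by (intro measurable_component_singleton)
  show "(\<lambda>x. threshold_procedure t n x i) \<in> measurable (\<Pi>\<^sub>M i\<in>{1..n}. borel) (count_space UNIV)"
    unfolding threshold_procedure_def by measurable
qed

text \<open>At most \<open>k\<close> rejections are true discoveries, so more than
  \<open>b * k\<close> rejections force at least \<open>(c - 1) * k\<close> false ones. Markov's
  inequality applies, each null coordinate being rejected with probability
  \<open>2 * Fbar f 0 (t n)\<close>. Keeping \<open>c\<close> apart from \<open>b\<close> allows a
  constant that does not depend on \<open>n\<close>.\<close>

lemma threshold_false_discoveries:
  assumes f: "density_family f" and sym: "\<And>x. f 0 (- x) = f 0 x" and t: "0 \<le> t n"
    and \<theta>: "card {i \<in> {1..n}. \<theta> i \<noteq> 0} \<le> k" and k: "1 \<le> k" and c: "1 < c" "c \<le> b"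
  shows "measure (obs_law f n \<theta>)
      {x \<in> space (obs_law f n \<theta>). (\<Sum>i=1..n. of_bool (threshold_procedure t n x i)) > b * real k}
    \<le> 2 / (c - 1) * (real n / real k * Fbar f 0 (t n))"
proof -
  let ?P = "obs_law f n \<theta>"
  define Z where "Z = {i \<in> {1..n}. \<theta> i = 0}"
  define E where "E i = {x \<in> space ?P. x i \<in> {y. t n < \<bar>y\<bar>}}" for i
  define F where "F x = (\<Sum>i\<in>Z. indicator (E i) x :: real)" for x
  interpret prob_space ?P using f by (rule prob_space_obs_law)
  have S: "{y::real. t n < \<bar>y\<bar>} \<in> sets borel" by measurable
  have Em: "E i \<in> sets ?P" if "i \<in> {1..n}" for i
    using testing_procedure_event[OF testing_procedure_threshold that, of f \<theta> t]
    by (simp add: E_def threshold_procedure_def)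
  have pE: "prob (E i) = 2 * Fbar f 0 (t n)" if "i \<in> Z" for i
    using measure_obs_law_component[OF f _ S, of i n \<theta>] that two_sided_tail[OF f sym t]
    by (simp add: E_def Z_def)
  have intE: "integrable ?P (\<lambda>x. indicator (E i) x :: real)" if "i \<in> Z" for i
    using Em that by (intro integrable_real_indicator) (auto simp: Z_def emeasure_eq_measure)
  have Fint: "integrable ?P F" unfolding F_def using intE by (intro Bochner_Integration.integrable_sum)
  have "(\<integral>x. F x \<partial>?P) = (\<Sum>i\<in>Z. prob (E i))"
    unfolding F_def using intE Em by (subst Bochner_Integration.integral_sum) (auto simp: Z_def)
  also have "\<dots> = real (card Z) * (2 * Fbar f 0 (t n))" by (simp add: pE)
  also have "\<dots> \<le> real n * (2 * Fbar f 0 (t n))"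
  proof (intro mult_right_mono)
    have "card Z \<le> card {1..n}" by (intro card_mono) (auto simp: Z_def)
    then show "real (card Z) \<le> real n" by simp
  qed (simp add: Fbar_eq_measure[OF f])
  finally have EF: "(\<integral>x. F x \<partial>?P) \<le> real n * (2 * Fbar f 0 (t n))" .
  have "prob {x \<in> space ?P. (\<Sum>i=1..n. of_bool (threshold_procedure t n x i)) > b * real k}
      \<le> prob {x \<in> space ?P. (c - 1) * real k \<le> F x}"
  proof (rule finite_measure_mono)
    show "{x \<in> space ?P. (c - 1) * real k \<le> F x} \<in> sets ?P"
      using Fint by measurable
    show "{x \<in> space ?P. (\<Sum>i=1..n. of_bool (threshold_procedure t n x i)) > b * real k}
        \<subseteq> {x \<in> space ?P. (c - 1) * real k \<le> F x}"
    proof safe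
      fix x assume x: "x \<in> space ?P"
        and big: "b * real k < (\<Sum>i=1..n. of_bool (threshold_procedure t n x i))"
      have split: "{1..n} = {i \<in> {1..n}. \<theta> i \<noteq> 0} \<union> Z" by (auto simp: Z_def)
      have "(\<Sum>i=1..n. of_bool (threshold_procedure t n x i) :: real)
          = (\<Sum>i\<in>{i \<in> {1..n}. \<theta> i \<noteq> 0}. of_bool (threshold_procedure t n x i))
            + (\<Sum>i\<in>Z. of_bool (threshold_procedure t n x i))"
        by (subst split, rule sum.union_disjoint) (auto simp: Z_def)
      also have "(\<Sum>i\<in>Z. of_bool (threshold_procedure t n x i)) = F x"
        unfolding F_def using x by (intro sum.cong) (auto simp: E_def threshold_procedure_def)
      also have "(\<Sum>i\<in>{i \<in> {1..n}. \<theta> i \<noteq> 0}. of_bool (threshold_procedure t n x i) :: real)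
          \<le> (\<Sum>i\<in>{i \<in> {1..n}. \<theta> i \<noteq> 0}. 1)" by (intro sum_mono) auto
      also have "\<dots> \<le> real k" using \<theta> by simp
      finally have "b * real k \<le> real k + F x" using big by linarith
      moreover have "c * real k \<le> b * real k" using c(2) by (intro mult_right_mono) auto
      ultimately show "(c - 1) * real k \<le> F x" by (simp add: algebra_simps)
    qed
  qed
  also have "\<dots> \<le> (\<integral>x. F x \<partial>?P) / ((c - 1) * real k)"
    using c k by (intro integral_Markov_inequality_measure[OF Fint sets.empty_sets])
      (auto simp: F_def intro!: sum_nonneg)
  also have "\<dots> \<le> real n * (2 * Fbar f 0 (t n)) / ((c - 1) * real k)"
    using EF c k by (intro divide_right_mono) auto
  finally show ?thesis by (simp add: field_simps)
qed

lemma threshold_sparsity_preserving: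
  assumes f: "density_family f" and sym: "\<And>x. f 0 (- x) = f 0 x" and t: "\<And>n. 0 \<le> t n"
    and s: "filterlim s at_top sequentially"
    and ns: "filterlim (\<lambda>n. real n / real (s n)) at_top sequentially"
    and lim: "(\<lambda>n. real n / real (s n) * Fbar f 0 (t n)) \<longlonglongrightarrow> 0"
    and B: "liminf (\<lambda>n. ereal (B n)) > 1"
  shows "threshold_procedure t \<in> sparsity_preserving_class f s (Theta a s) B"
proof -
  define W where "W n \<theta> = measure (obs_law f n \<theta>) {x \<in> space (obs_law f n \<theta>).
      (\<Sum>i=1..n. of_bool (threshold_procedure t n x i)) > B n * real (s n)}" for n \<theta>
  \<comment> \<open>A fixed \<open>c\<close> strictly between \<open>1\<close> and the lower limit
    keeps the factor \<open>2 / (c - 1)\<close> bounded along the sequence.\<close>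
  obtain c where "1 < ereal c" and cB: "ereal c < liminf (\<lambda>n. ereal (B n))"
    using ereal_dense2[OF B] by auto
  then have c: "1 < c" by simp
  have cB: "\<forall>\<^sub>F n in sequentially. c < B n" using less_LiminfD[OF cB] by simp
  have s1: "\<forall>\<^sub>F n in sequentially. 1 \<le> s n" using s by (simp add: filterlim_at_top)
  have ns1: "\<forall>\<^sub>F n in sequentially. 1 \<le> real n / real (s n)" using ns by (simp add: filterlim_at_top)
  \<comment> \<open>The supremum is controlled over a nonempty bounded set; nonemptiness comes from
    \<open>s n \<le> n\<close>, valid for large \<open>n\<close>.\<close>
  have "\<forall>\<^sub>F n in sequentially. 0 \<le> (SUP \<theta>\<in>Theta a s n. W n \<theta>) \<and>
      (SUP \<theta>\<in>Theta a s n. W n \<theta>) \<le> 2 / (c - 1) * (real n / real (s n) * Fbar f 0 (t n))"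
    using cB s1 ns1
  proof eventually_elim
    case (elim n)
    have "s n \<le> n" using elim(2,3) by (simp add: field_simps)
    then have ne: "Theta a s n \<noteq> {}" by (rule Theta_nonempty)
    then obtain \<eta> where \<eta>: "\<eta> \<in> Theta a s n" by auto
    have le: "W n \<theta> \<le> 2 / (c - 1) * (real n / real (s n) * Fbar f 0 (t n))" if "\<theta> \<in> Theta a s n" for \<theta>
      unfolding W_def using that elim c t
      by (intro threshold_false_discoveries[OF f sym]) (auto simp: Theta_def l0_ball_def)
    then have "bdd_above (W n ` Theta a s n)"
      by (intro bdd_aboveI[of _ "2 / (c - 1) * (real n / real (s n) * Fbar f 0 (t n))"]) auto
    then have "W n \<eta> \<le> (SUP \<theta>\<in>Theta a s n. W n \<theta>)" using \<eta> by (intro cSUP_upper)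
    then have "0 \<le> (SUP \<theta>\<in>Theta a s n. W n \<theta>)"
      using measure_nonneg[of "obs_law f n \<eta>"] unfolding W_def by (rule order_trans[rotated])
    then show ?case using le ne by (auto intro: cSUP_least)
  qed
  then have ev: "\<forall>\<^sub>F n in sequentially. 0 \<le> (SUP \<theta>\<in>Theta a s n. W n \<theta>)"
    "\<forall>\<^sub>F n in sequentially. (SUP \<theta>\<in>Theta a s n. W n \<theta>) \<le> 2 / (c - 1) * (real n / real (s n) * Fbar f 0 (t n))"
    by (auto elim: eventually_mono)
  have "(\<lambda>n. SUP \<theta>\<in>Theta a s n. W n \<theta>) \<longlonglongrightarrow> 0"
    by (rule tendsto_sandwich[OF ev tendsto_const]) (rule tendsto_mult_right_zero[OF lim])
  then show ?thesis
    using testing_procedure_threshold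
    unfolding sparsity_preserving_class_def sparsity_preserving_def W_def by blast
qed

text \<open>Since \<open>w n j\<close> bounds the power uniformly over all parameters of size at
  least \<open>a n j\<close>, the estimate holds for every \<open>\<theta>\<close> in the class,
  with remainder \<open>0\<close> once \<open>n\<close> is large.\<close>

lemma threshold_sup_FNR:
  assumes f: "density_family f"
    and s: "filterlim s at_top sequentially"
    and ns: "filterlim (\<lambda>n. real n / real (s n)) at_top sequentially"
    and apos: "\<And>n j. j \<in> {1..s n} \<Longrightarrow> 0 < a n j"
    and w: "\<And>n j \<theta>. j \<in> {1..s n} \<Longrightarrow> a n j \<le> \<bar>\<theta>\<bar> \<Longrightarrow> w n j \<le> measure (signal_law f \<theta>) {x. t n < \<bar>x\<bar>}"
  shows "le_up_to_o1 (sup_FNR f (Theta a s) (threshold_procedure t)) (\<lambda>n. 1 - (\<Sum>j=1..s n. w n j) / real (s n))"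
proof (rule le_up_to_o1I)
  have s1: "\<forall>\<^sub>F n in sequentially. 1 \<le> s n" using s by (simp add: filterlim_at_top)
  have ns1: "\<forall>\<^sub>F n in sequentially. 1 \<le> real n / real (s n)" using ns by (simp add: filterlim_at_top)
  show "\<forall>\<^sub>F n in sequentially. sup_FNR f (Theta a s) (threshold_procedure t) n
      \<le> 1 - (\<Sum>j=1..s n. w n j) / real (s n) + 0"
    using s1 ns1
  proof eventually_elim
    case (elim n)
    have "s n \<le> n" using elim by (simp add: field_simps)
    then have ne: "Theta a s n \<noteq> {}" by (rule Theta_nonempty)
    have "FNR f (threshold_procedure t) n \<theta> \<le> 1 - (\<Sum>j=1..s n. w n j) / real (s n)"
      if \<theta>: "\<theta> \<in> Theta a s n" for \<theta>
    proof -
      obtain \<iota> where \<iota>: "inj_on \<iota> {1..s n}" "{i \<in> {1..n}. \<theta> i \<noteq> 0} = \<iota> ` {1..s n}"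
        and le: "\<And>j. j \<in> {1..s n} \<Longrightarrow> a n j \<le> \<bar>\<theta> (\<iota> j)\<bar>"
        using Theta_support[where a=a and s=s, OF \<theta> apos] by metis
      have "(\<Sum>j=1..s n. w n j) \<le> (\<Sum>j=1..s n. measure (obs_law f n \<theta>)
          {x \<in> space (obs_law f n \<theta>). threshold_procedure t n x (\<iota> j)})"
      proof (rule sum_mono)
        fix j assume j: "j \<in> {1..s n}"
        then have ij: "\<iota> j \<in> {1..n}" using \<iota>(2) by blast
        have S: "{y::real. t n < \<bar>y\<bar>} \<in> sets borel" by measurable
        show "w n j \<le> measure (obs_law f n \<theta>) {x \<in> space (obs_law f n \<theta>). threshold_procedure t n x (\<iota> j)}"
          using w[OF j le[OF j]] measure_obs_law_component[OF f ij S, of \<theta>]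
          by (simp add: threshold_procedure_def)
      qed
      then have "(\<Sum>j=1..s n. w n j) / real (s n) \<le> (\<Sum>j=1..s n. measure (obs_law f n \<theta>)
          {x \<in> space (obs_law f n \<theta>). threshold_procedure t n x (\<iota> j)}) / real (s n)"
        by (rule divide_right_mono) simp
      then show ?thesis
        using FNR_support[OF f testing_procedure_threshold \<iota> elim(1), of t] by linarith
    qed
    then show ?case unfolding sup_FNR_def using ne by (simp add: cSUP_least)
  qed
qed simp

section \<open>Eventual equalities and the shift of the threshold\<close>

lemma le_up_to_o1_cong:
  assumes "\<forall>\<^sub>F n in sequentially. u n = u' n"
  shows "le_up_to_o1 u v \<longleftrightarrow> le_up_to_o1 u' v" "le_up_to_o1 v u \<longleftrightarrow> le_up_to_o1 v u'"
proof -
  have *: "le_up_to_o1 u2 v2" if "le_up_to_o1 u1 v1" "\<forall>\<^sub>F n in sequentially. u1 n = u2 n \<and> v1 n = v2 n"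
    for u1 u2 v1 v2
  proof -
    obtain e where e: "e \<longlonglongrightarrow> 0" "\<And>n. u1 n \<le> v1 n + e n"
      using \<open>le_up_to_o1 u1 v1\<close> unfolding le_up_to_o1_def by blast
    have "\<forall>\<^sub>F n in sequentially. u2 n \<le> v2 n + e n"
      using that(2) by eventually_elim (metis e(2))
    then show ?thesis using e(1) by (rule le_up_to_o1I)
  qed
  show "le_up_to_o1 u v \<longleftrightarrow> le_up_to_o1 u' v" "le_up_to_o1 v u \<longleftrightarrow> le_up_to_o1 v u'"
    using assms by (auto elim!: * elim: eventually_mono)
qed

text \<open>The identity is only eventual: for \<open>s n = 0\<close>, division by zero makes the
  left side \<open>0\<close> and the right side \<open>1\<close>.\<close>

lemma Lambda_eq:
  assumes "filterlim s at_top sequentially"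
  shows "\<forall>\<^sub>F n in sequentially. Lambda f s t a n = 1 - (\<Sum>j=1..s n. Fbar f (a n j) (t n)) / real (s n)"
proof -
  have "\<forall>\<^sub>F n in sequentially. 1 \<le> s n" using assms by (simp add: filterlim_at_top)
  then show ?thesis
    by eventually_elim (simp add: Lambda_def Fbar_def sum_subtractf diff_divide_distrib)
qed

text \<open>The cost of returning from the threshold \<open>astar - \<delta>\<close> to
  \<open>astar\<close>. As the same \<open>L\<close> serves every parameter, it vanishes uniformly
  over the signals.\<close>

lemma Fbar_shift:
  assumes "L-lipschitz_on UNIV (Fcdf f a)" "0 \<le> d"
  shows "Fbar f a (x - d) \<le> Fbar f a x + L * d"
  using lipschitz_onD[OF assms(1), of x "x - d"] assms(2) by (simp add: Fbar_def dist_real_def)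

section \<open>Matching bounds in the one-sided and the two-sided case\<close>

theorem theorem6:
  fixes f :: "real \<Rightarrow> real \<Rightarrow> real"
    and s :: "nat \<Rightarrow> nat"
    and astar \<delta> B :: "nat \<Rightarrow> real"
    and a :: "nat \<Rightarrow> nat \<Rightarrow> real"
  defines "\<Theta> \<equiv> Theta a s"
    and "S \<equiv> sparsity_preserving_class f s (Theta a s) B"
    and "\<Lambda> \<equiv> Lambda f s astar a"
    and "thr \<equiv> threshold_procedure astar"
  assumes "density_family f"
    and "filterlim s at_top sequentially"
    and "filterlim (\<lambda>n. real n / real (s n)) at_top sequentially"
    and "\<And>n j. j \<in> {1..s n} \<Longrightarrow> 0 < a n j"
    and "\<forall>\<^sub>F n in sequentially.
           (B n)\<^sup>2 \<le> 1 / 3 * (real n / real (s n)) * Fbar f 0 (astar n - \<delta> n)"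
    and "liminf (\<lambda>n. ereal (B n)) > 1"
  shows
    "(assumption_1A f s astar \<delta> \<longrightarrow>
        inf_eq_up_to_o1 S (sup_FNR f \<Theta>) \<Lambda> \<and>
        thr \<in> S \<and> le_up_to_o1 (sup_FNR f \<Theta> thr) \<Lambda>) \<and>
     (assumption_1B f s astar \<delta> \<longrightarrow>
        (\<forall>\<phi>\<in>S. le_up_to_o1 (\<lambda>n. 2 * \<Lambda> n - 1) (sup_FNR f \<Theta> \<phi>)) \<and>
        thr \<in> S \<and>
        (negative_tails_dominate f \<longrightarrow>
           inf_eq_up_to_o1 S (sup_FNR f \<Theta>) (\<lambda>n. 2 * \<Lambda> n - 1) \<and>
           le_up_to_o1 (sup_FNR f \<Theta> thr) (\<lambda>n. 2 * \<Lambda> n - 1)))"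
proof -
  note f = assms(5) and s = assms(6) and ns = assms(7) and apos = assms(8) and B = assms(9,10)
  \<comment> \<open>The bound on the square leaves the sign of \<open>B n\<close> open; the lower
    limit settles it for large \<open>n\<close>.\<close>
  have "\<forall>\<^sub>F n in sequentially. 1 < B n" using less_LiminfD[OF B(2)] by (simp add: one_ereal_def)
  then have B0: "\<forall>\<^sub>F n in sequentially. 0 \<le> B n" by (rule eventually_mono) simp
  define wA where "wA n j = Fbar f (a n j) (astar n)" for n j
  \<comment> \<open>The factor \<open>2\<close> counts both tails and turns one minus the average
    power into \<open>2 * \<Lambda> n - 1\<close>.\<close>
  define wB where "wB n j = 2 * Fbar f (a n j) (astar n)" for n j
  have \<Lambda>A: "\<forall>\<^sub>F n in sequentially. \<Lambda> n = 1 - (\<Sum>j=1..s n. wA n j) / real (s n)"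
    unfolding \<Lambda>_def wA_def by (rule Lambda_eq[OF s])
  have \<Lambda>B: "\<forall>\<^sub>F n in sequentially. 2 * \<Lambda> n - 1 = 1 - (\<Sum>j=1..s n. wB n j) / real (s n)"
    using \<Lambda>A by eventually_elim (simp add: wA_def wB_def sum_distrib_left[symmetric])
  have caseA: "(\<forall>\<phi>\<in>S. le_up_to_o1 \<Lambda> (sup_FNR f \<Theta> \<phi>)) \<and> thr \<in> S \<and> le_up_to_o1 (sup_FNR f \<Theta> thr) \<Lambda>"
    if "assumption_1A f s astar \<delta>"
  proof -
    have com: "assumption_1_common f s astar \<delta>" and sym: "\<And>a x. f (- a) (- x) = f a x"
      and tail: "\<And>x. mono (\<lambda>a. Fbar f a x)" and ratio: "\<And>a. 0 < a \<Longrightarrow> mono (\<lambda>x. f a x / f 0 x)"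
      using that by (auto simp: assumption_1A_def)
    obtain L where L: "\<And>a. L-lipschitz_on UNIV (Fcdf f a)" and astar: "\<And>n. 0 < astar n"
      and \<delta>: "\<And>n. 0 < \<delta> n" "\<delta> \<longlonglongrightarrow> 0"
      and big: "filterlim (\<lambda>n. real n / real (s n) * Fbar f 0 (astar n - \<delta> n)) at_top sequentially"
      and small: "(\<lambda>n. real n / real (s n) * Fbar f 0 (astar n)) \<longlonglongrightarrow> 0" and pos: "\<And>x. 0 < f 0 x"
      using com unfolding assumption_1_common_def by blast
    \<comment> \<open>All signals of the prior are positive, so a monotone ratio makes the upper
      tail the optimal region, although the attaining procedure is two-sided.\<close>
    have "le_up_to_o1 \<Lambda> (sup_FNR f \<Theta> \<phi>)" if "\<phi> \<in> S" for \<phi>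
      unfolding le_up_to_o1_cong(1)[OF \<Lambda>A] \<Theta>_def
    proof (rule sparsity_preserving_lower_bound[OF f that[unfolded S_def] s ns apos B0 B(1) big,
          where T="\<lambda>n. {astar n - \<delta> n<..}" and d="\<lambda>n. L * \<delta> n"])
      show "\<forall>\<^sub>F n in sequentially. \<forall>j\<in>{1..s n}. likelihood_ratio_test f 0 (a n j) {astar n - \<delta> n<..}"
        using apos pos ratio by (intro always_eventually allI ballI likelihood_ratio_test_upper_tail[OF f]) auto
      show "\<forall>\<^sub>F n in sequentially. \<forall>j\<in>{1..s n}.
          measure (signal_law f (a n j)) {astar n - \<delta> n<..} \<le> wA n j + L * \<delta> n"
        using Fbar_shift[OF L less_imp_le[OF \<delta>(1)]] by (simp add: wA_def Fbar_eq_measure[OF f])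
      show "(\<lambda>n. L * \<delta> n) \<longlonglongrightarrow> 0" using \<delta>(2) by (rule tendsto_mult_right_zero)
    qed (simp_all add: Fbar_eq_measure[OF f])
    moreover have "thr \<in> S" unfolding thr_def S_def
      using sym[of 0] astar
      by (intro threshold_sparsity_preserving[OF f _ _ s ns small B(2)]) (auto intro: less_imp_le)
    moreover have "le_up_to_o1 (sup_FNR f \<Theta> thr) \<Lambda>"
      unfolding le_up_to_o1_cong(2)[OF \<Lambda>A] \<Theta>_def thr_def
    proof (rule threshold_sup_FNR[OF f s ns apos])
      fix n j \<theta> assume j: "j \<in> {1..s n}" and \<theta>: "a n j \<le> \<bar>\<theta>\<bar>"
      have "measure (signal_law f \<theta>) {x. astar n < \<bar>x\<bar>} = Fbar f \<theta> (astar n) + Fbar f (- \<theta>) (astar n)"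
        using astar by (intro two_sided_tail[OF f] sym) (auto intro: less_imp_le)
      moreover have "0 \<le> Fbar f \<theta> (astar n)" "0 \<le> Fbar f (- \<theta>) (astar n)"
        by (simp_all add: Fbar_eq_measure[OF f])
      \<comment> \<open>The two tails belong to \<open>\<bar>\<theta>\<bar>\<close> and its
        negative, in an order given by the sign of \<open>\<theta>\<close>; the second is dropped as
        nonnegative.\<close>
      ultimately have "Fbar f \<bar>\<theta>\<bar> (astar n) \<le> measure (signal_law f \<theta>) {x. astar n < \<bar>x\<bar>}"
        by (simp add: abs_if)
      moreover have "wA n j \<le> Fbar f \<bar>\<theta>\<bar> (astar n)" unfolding wA_def using monoD[OF tail \<theta>] .
      ultimately show "wA n j \<le> measure (signal_law f \<theta>) {x. astar n < \<bar>x\<bar>}" by linarith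
    qed
    ultimately show ?thesis by blast
  qed
  have caseB: "(\<forall>\<phi>\<in>S. le_up_to_o1 (\<lambda>n. 2 * \<Lambda> n - 1) (sup_FNR f \<Theta> \<phi>)) \<and> thr \<in> S \<and>
      (negative_tails_dominate f \<longrightarrow> le_up_to_o1 (sup_FNR f \<Theta> thr) (\<lambda>n. 2 * \<Lambda> n - 1))"
    if "assumption_1B f s astar \<delta>"
  proof -
    have com: "assumption_1_common f s astar \<delta>" and sym: "\<And>a x. f a (- x) = f a x"
      and tail: "\<And>x. 0 < x \<Longrightarrow> mono_on {0<..} (\<lambda>a. Fbar f a x)"
      and ratio: "\<And>a. a \<noteq> 0 \<Longrightarrow> mono_on {0<..} (\<lambda>x. f a x / f 0 x)"
      using that by (auto simp: assumption_1B_def)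
    obtain L where L: "\<And>a. L-lipschitz_on UNIV (Fcdf f a)" and astar: "\<And>n. 0 < astar n"
      and astar_lim: "filterlim astar at_top sequentially"
      and \<delta>: "\<And>n. 0 < \<delta> n" "\<delta> \<longlonglongrightarrow> 0"
      and big: "filterlim (\<lambda>n. real n / real (s n) * Fbar f 0 (astar n - \<delta> n)) at_top sequentially"
      and small: "(\<lambda>n. real n / real (s n) * Fbar f 0 (astar n)) \<longlonglongrightarrow> 0" and pos: "\<And>x. 0 < f 0 x"
      using com unfolding assumption_1_common_def by blast
    have two: "measure (signal_law f b) {x. t < \<bar>x\<bar>} = 2 * Fbar f b t" if "0 < t" for b t
      using two_sided_tail[OF f sym, of t b] that by simp
    have Fbar0: "0 \<le> Fbar f b t" for b t by (simp add: Fbar_eq_measure[OF f])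
    \<comment> \<open>The two-sided region is a likelihood ratio test only at a positive threshold,
      which the limits of \<open>astar\<close> and \<open>\<delta>\<close> ensure for large
      \<open>n\<close>.\<close>
    have "\<forall>\<^sub>F n in sequentially. 1 \<le> astar n" using astar_lim by (simp add: filterlim_at_top)
    moreover have "\<forall>\<^sub>F n in sequentially. \<delta> n < 1" using \<delta>(2) by (rule order_tendstoD) simp
    ultimately have t: "\<forall>\<^sub>F n in sequentially. 0 < astar n - \<delta> n" by eventually_elim simp
    have "le_up_to_o1 (\<lambda>n. 2 * \<Lambda> n - 1) (sup_FNR f \<Theta> \<phi>)" if "\<phi> \<in> S" for \<phi>
      unfolding le_up_to_o1_cong(1)[OF \<Lambda>B] \<Theta>_def
    proof (rule sparsity_preserving_lower_bound[OF f that[unfolded S_def] s ns apos B0 B(1) big,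
          where T="\<lambda>n. {x. astar n - \<delta> n < \<bar>x\<bar>}" and d="\<lambda>n. 2 * L * \<delta> n"])
      show "\<forall>\<^sub>F n in sequentially. \<forall>j\<in>{1..s n}.
          likelihood_ratio_test f 0 (a n j) {x. astar n - \<delta> n < \<bar>x\<bar>}"
        using t
      proof eventually_elim
        case (elim n)
        show ?case
          using apos by (intro ballI likelihood_ratio_test_two_sided[OF f pos ratio sym sym elim]) fastforce
      qed
      show "\<forall>\<^sub>F n in sequentially. \<forall>j\<in>{1..s n}.
          measure (signal_law f (a n j)) {x. astar n - \<delta> n < \<bar>x\<bar>} \<le> wB n j + 2 * L * \<delta> n"
        using t
      proof eventually_elim
        case (elim n)
        have "2 * Fbar f b (astar n - \<delta> n) \<le> 2 * Fbar f b (astar n) + 2 * L * \<delta> n" for b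
          using Fbar_shift[OF L less_imp_le[OF \<delta>(1)[of n]], of b "astar n"] by simp
        then show ?case by (simp add: two[OF elim] wB_def)
      qed
      show "(\<lambda>n. 2 * L * \<delta> n) \<longlonglongrightarrow> 0" using \<delta>(2) by (rule tendsto_mult_right_zero)
      \<comment> \<open>The two-sided null probability is twice the tail, so the single tail is a
        valid lower bound and the condition on \<open>B\<close> fits unchanged.\<close>
      show "\<forall>\<^sub>F n in sequentially.
          Fbar f 0 (astar n - \<delta> n) \<le> measure (signal_law f 0) {x. astar n - \<delta> n < \<bar>x\<bar>}"
        using t by eventually_elim (use Fbar0 in \<open>simp add: two\<close>)
    qed
    moreover have "thr \<in> S" unfolding thr_def S_def
      using sym astar
      by (intro threshold_sparsity_preserving[OF f _ _ s ns small B(2)]) (auto intro: less_imp_le)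
    moreover have "le_up_to_o1 (sup_FNR f \<Theta> thr) (\<lambda>n. 2 * \<Lambda> n - 1)" if neg: "negative_tails_dominate f"
      unfolding le_up_to_o1_cong(2)[OF \<Lambda>B] \<Theta>_def thr_def
    proof (rule threshold_sup_FNR[OF f s ns apos])
      fix n j \<theta> assume j: "j \<in> {1..s n}" and \<theta>: "a n j \<le> \<bar>\<theta>\<bar>"
      have "Fbar f (a n j) (astar n) \<le> Fbar f \<bar>\<theta>\<bar> (astar n)"
        using mono_onD[OF tail[OF astar] _ _ \<theta>] apos[OF j] \<theta> by auto
      \<comment> \<open>Monotonicity in the parameter covers positive values only; for negative
        \<open>\<theta>\<close> the comparison with \<open>- \<theta>\<close> is exactly
        \<open>negative_tails_dominate\<close>.\<close>
      also have "\<dots> \<le> Fbar f \<theta> (astar n)"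
        using neg astar[of n] apos[OF j] \<theta> unfolding negative_tails_dominate_def
        by (cases "0 \<le> \<theta>") (auto dest: spec[of _ "- \<theta>"])
      finally show "wB n j \<le> measure (signal_law f \<theta>) {x. astar n < \<bar>x\<bar>}"
        by (simp add: two[OF astar] wB_def)
    qed
    ultimately show ?thesis by blast
  qed
  show ?thesis using caseA caseB unfolding inf_eq_up_to_o1_def by blast
qed

end
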